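(* If $\mathcal{A}$ is an infinite minimally generated Boolean algebra, then $\mathcal{A}$ does not have the $\ell_1$-Grothendieck property.
   Context: A Boolean algebra $\mathcal{B}$ is a minimal extension of its subalgebra $\mathcal{C}$ if there is no subalgebra $\mathcal{D}$ with $\mathcal{C}\subsetneq\mathcal{D}\subsetneq\mathcal{B}$. A Boolean algebra $\mathcal{A}$ is minimally generated if there is an increasing sequence $\langle\mathcal{A}_\alpha\colon\alpha\le\delta\rangle$ of subalgebras of $\mathcal{A}$ with $\mathcal{A}_0=\{0,1\}$, $\mathcal{A}_\delta=\mathcal{A}$, $\mathcal{A}_{\alpha+1}$ a minimal extension of $\mathcal{A}_\alpha$ for every $\alpha<\delta$, and $\mathcal{A}_\gamma=\bigcup_{\alpha<\gamma}\mathcal{A}_\alpha$ for every limit $\gamma\le\delta$. (In terms of Stone spaces this is dual to limits of inverse systems of simple extensions.) $St(\mathcal{A})$ denotes the Stone space of $\mathcal{A}$. For a compact Hausdorff space $K$, measures are signed Radon measures on $K$, and $\ell_1(K)$ is the space of countably supported measures on $K$ (of the form $\sum_x\alpha_x\delta_x$ with $\sum_x|\alpha_x|<\infty$). A sequence of measures $\mu_n$ is weakly* convergent to $\mu$ if $\int_K f\,d\mu_n\to\int_K f\,d\mu$ for all $f\in C(K)$, and weakly convergent to $\mu$ if $\mu_n(B)\to\mu(B)$ for all Borel $B\subseteq K$. $K$ has the $\ell_1$-Grothendieck property if every weakly* convergent sequence of measures from $\ell_1(K)$ is weakly convergent; $\mathcal{A}$ has the $\ell_1$-Grothendieck property if $St(\mathcal{A})$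 has it. *)

theory Defs
  imports "HOL-Analysis.Analysis"
begin

section \<open>Minimally generated Boolean algebras\<close>

definition subalgebra :: "'a::boolean_algebra set \<Rightarrow> bool" where
  "subalgebra B \<longleftrightarrow>
     bot \<in> B \<and> top \<in> B \<and> (\<forall>x\<in>B. - x \<in> B) \<and>
     (\<forall>x\<in>B. \<forall>y\<in>B. inf x y \<in> B) \<and> (\<forall>x\<in>B. \<forall>y\<in>B. sup x y \<in> B)"

text \<open>The trivial case \<open>B = C\<close> is not excluded.\<close>

definition minimal_extension :: "'a::boolean_algebra set \<Rightarrow> 'a set \<Rightarrow> bool" where
  "minimal_extension C B \<longleftrightarrow>
     subalgebra C \<and> subalgebra B \<and> C \<subseteq> B \<and>
     \<not> (\<exists>D. subalgebra D \<and> C \<subset> D \<and> D \<subset> B)"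

text \<open>
  A continuous increasing sequence indexed by the ordinals up to and including an ordinal is
  modelled by a well-order \<open>r\<close> with a last element \<open>\<delta>\<close>. The successor of \<open>\<alpha>\<close> is the
  \<open>\<beta>\<close> with \<open>underS r \<beta> = under r \<alpha>\<close>, that is, the elements strictly below \<open>\<beta>\<close> are
  those weakly below \<open>\<alpha>\<close>. A limit is an element that is neither the first one nor a successor.
\<close>

definition generating_sequence :: "'i rel \<Rightarrow> 'i \<Rightarrow> ('i \<Rightarrow> 'a::boolean_algebra set) \<Rightarrow> bool" where
  "generating_sequence r \<delta> A \<longleftrightarrow>
     Well_order r \<and> \<delta> \<in> Field r \<and> (\<forall>\<alpha>\<in>Field r. (\<alpha>, \<delta>) \<in> r) \<and>
     (\<forall>\<alpha>\<in>Field r. subalgebra (A \<alpha>)) \<and>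
     (\<forall>\<alpha> \<beta>. (\<alpha>, \<beta>) \<in> r \<longrightarrow> A \<alpha> \<subseteq> A \<beta>) \<and>
     (\<forall>\<alpha>\<in>Field r. underS r \<alpha> = {} \<longrightarrow> A \<alpha> = {bot, top}) \<and>
     A \<delta> = UNIV \<and>
     (\<forall>\<alpha>\<in>Field r. \<forall>\<beta>\<in>Field r. underS r \<beta> = under r \<alpha> \<longrightarrow> minimal_extension (A \<alpha>) (A \<beta>)) \<and>
     (\<forall>\<gamma>\<in>Field r. underS r \<gamma> \<noteq> {} \<and> \<not> (\<exists>\<alpha>\<in>Field r. underS r \<gamma> = under r \<alpha>) \<longrightarrow>
        A \<gamma> = (\<Union>\<alpha>\<in>underS r \<gamma>. A \<alpha>))"

text \<open>
  The algebra is the whole type \<open>'a\<close>. A definition cannot quantify over the type of indices;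
  the type \<open>'a set\<close> is large enough, as \<open>minimally_generatedI\<close> below shows.
\<close>

definition minimally_generated :: "'a::boolean_algebra itself \<Rightarrow> bool" where
  "minimally_generated _ \<longleftrightarrow>
     (\<exists>(r :: 'a set rel) \<delta> (A :: 'a set \<Rightarrow> 'a set). generating_sequence r \<delta> A)"

lemma minimally_generatedI:
  fixes r :: "'i rel" and A :: "'i \<Rightarrow> 'a::boolean_algebra set"
  assumes "generating_sequence r \<delta> A"
  shows "minimally_generated TYPE('a)"
proof -
  have gs: "Well_order r" "\<delta> \<in> Field r" "\<forall>\<alpha>\<in>Field r. (\<alpha>, \<delta>) \<in> r"
    "\<forall>\<alpha>\<in>Field r. subalgebra (A \<alpha>)"
    "\<forall>\<alpha> \<beta>. (\<alpha>, \<beta>) \<in> r \<longrightarrow> A \<alpha> \<subseteq> A \<beta>"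
    "\<forall>\<alpha>\<in>Field r. underS r \<alpha> = {} \<longrightarrow> A \<alpha> = {bot, top}"
    "A \<delta> = UNIV"
    "\<forall>\<alpha>\<in>Field r. \<forall>\<beta>\<in>Field r. underS r \<beta> = under r \<alpha> \<longrightarrow> minimal_extension (A \<alpha>) (A \<beta>)"
    "\<forall>\<gamma>\<in>Field r. underS r \<gamma> \<noteq> {} \<and> \<not> (\<exists>\<alpha>\<in>Field r. underS r \<gamma> = under r \<alpha>) \<longrightarrow>
        A \<gamma> = (\<Union>\<alpha>\<in>underS r \<gamma>. A \<alpha>)"
    using assms[unfolded generating_sequence_def] by - (elim conjE, assumption)+
  note wo = gs(1) and last = gs(2) gs(3)[rule_format] and sub = gs(4)[rule_format]
    and mono = gs(5)[rule_format] and zero = gs(6)[rule_format] and all = gs(7)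
    and succ = gs(8)[rule_format] and lim = gs(9)[rule_format, OF _ conjI]
  have wr: "wo_rel r" by (simp add: wo_rel_def wo)
  note TOTALS = wo_rel.TOTALS[OF wr] and LIN = wo_rel.LIN[OF wr]
    and REFL = wo_rel.REFL[OF wr] and ANTISYM = wo_rel.ANTISYM[OF wr]
  have tot: "(\<alpha>, \<beta>) \<in> r \<or> (\<beta>, \<alpha>) \<in> r" if "\<alpha> \<in> Field r" "\<beta> \<in> Field r" for \<alpha> \<beta>
    using TOTALS that by blast
  have least: "\<exists>\<alpha>\<in>S. \<forall>\<beta>\<in>S. (\<alpha>, \<beta>) \<in> r" if "S \<subseteq> Field r" "S \<noteq> {}" for S
    using Linear_order_Well_order_iff[OF LIN] wo that by blast
  define C where "C = A ` Field r"
  define r' where "r' = {(X, Y). X \<in> C \<and> Y \<in> C \<and> X \<subseteq> Y}"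
  have fld: "Field r' = C" by (auto simp: r'_def Field_def)
  have "Linear_order r'"
    unfolding linear_order_on_def partial_order_on_def preorder_on_def fld
  proof (intro conjI)
    show "r' \<subseteq> C \<times> C" "refl_on C r'" "trans r'" "antisym r'"
      by (auto simp: r'_def refl_on_def trans_def antisym_def)
    show "total_on C r'"
      unfolding total_on_def r'_def C_def using tot mono by blast
  qed
  moreover have "\<exists>X\<in>Q. \<forall>Y\<in>Q. (X, Y) \<in> r'" if Q: "Q \<subseteq> Field r'" "Q \<noteq> {}" for Q
  proof -
    let ?S = "{\<alpha> \<in> Field r. A \<alpha> \<in> Q}"
    have "?S \<noteq> {}" using Q by (auto simp: fld C_def)
    then obtain \<alpha> where \<alpha>: "\<alpha> \<in> ?S" "\<forall>\<beta>\<in>?S. (\<alpha>, \<beta>) \<in> r" using least[of ?S] by auto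
    have "(A \<alpha>, Y) \<in> r'" if "Y \<in> Q" for Y
    proof -
      obtain \<beta> where "\<beta> \<in> Field r" "Y = A \<beta>" using Q(1) \<open>Y \<in> Q\<close> unfolding fld C_def by blast
      then show ?thesis using \<alpha> that mono[of \<alpha> \<beta>] by (simp add: r'_def C_def)
    qed
    then show ?thesis using \<alpha> by blast
  qed
  ultimately have wo': "Well_order r'"
    using Linear_order_Well_order_iff by blast
  have first: "\<exists>\<beta>\<in>Field r. A \<beta> = Y \<and> underS r' Y = A ` underS r \<beta> \<and>
                 (\<forall>\<gamma>\<in>underS r \<beta>. A \<gamma> \<subset> A \<beta>)" if "Y \<in> C" for Y
  proof -
    let ?S = "{\<alpha> \<in> Field r. A \<alpha> = Y}"
    have "?S \<noteq> {}" using that by (auto simp: C_def)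
    then obtain \<beta> where \<beta>: "\<beta> \<in> ?S" "\<forall>\<alpha>\<in>?S. (\<beta>, \<alpha>) \<in> r" using least[of ?S] by auto
    have lt: "A \<gamma> \<subset> A \<beta>" if "\<gamma> \<in> underS r \<beta>" for \<gamma>
    proof -
      have g: "(\<gamma>, \<beta>) \<in> r" "\<gamma> \<noteq> \<beta>" "\<gamma> \<in> Field r" using that by (auto simp: underS_def intro: FieldI1)
      have "A \<gamma> \<noteq> A \<beta>"
      proof
        assume "A \<gamma> = A \<beta>"
        then have "(\<beta>, \<gamma>) \<in> r" using \<beta> g(3) by simp
        then show False using antisymD[OF ANTISYM g(1)] g(2) by blast
      qed
      then show ?thesis using mono[OF g(1)] by blast
    qed
    have eq: "underS r' Y = A ` underS r \<beta>"
    proof (intro equalityI subsetI)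
      fix X assume "X \<in> underS r' Y"
      then obtain \<gamma> where g: "\<gamma> \<in> Field r" "X = A \<gamma>" "A \<gamma> \<subset> A \<beta>"
        using \<beta> by (auto simp: underS_def r'_def C_def)
      then have "(\<gamma>, \<beta>) \<in> r" using tot[of \<gamma> \<beta>] \<beta>(1) mono[of \<beta> \<gamma>] by blast
      then show "X \<in> A ` underS r \<beta>" using g by (auto simp: underS_def)
    next
      fix X assume "X \<in> A ` underS r \<beta>"
      then obtain \<gamma> where g: "\<gamma> \<in> underS r \<beta>" "X = A \<gamma>" by blast
      then show "X \<in> underS r' Y"
        using lt[OF g(1)] \<beta>(1) by (auto simp: underS_def r'_def C_def intro: FieldI1)
    qed
    show ?thesis
    proof (intro bexI conjI ballI)
      show "A \<beta> = Y" "\<beta> \<in> Field r" using \<beta>(1) by simp_all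
    qed (use eq lt in simp_all)
  qed
  have "generating_sequence r' UNIV (\<lambda>X. X)"
    unfolding generating_sequence_def
  proof (intro conjI ballI allI impI)
    show "Well_order r'" by (rule wo')
    have U: "UNIV \<in> C" unfolding C_def using last(1) all by (metis imageI)
    then show "UNIV \<in> Field r'" by (simp add: fld)
    show "(X, UNIV) \<in> r'" if "X \<in> Field r'" for X
      using that U unfolding fld by (simp add: r'_def)
    show "subalgebra X" if "X \<in> Field r'" for X
      using that sub unfolding fld C_def by blast
    show "X \<subseteq> Y" if "(X, Y) \<in> r'" for X Y
      using that by (auto simp: r'_def)
    show "X = {bot, top}" if "X \<in> Field r'" "underS r' X = {}" for X
    proof -
      obtain \<beta> where \<beta>: "\<beta> \<in> Field r" "A \<beta> = X" "underS r' X = A ` underS r \<beta>"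
        using first[of X] \<open>X \<in> Field r'\<close> unfolding fld by blast
      then have "underS r \<beta> = {}" using that(2) by simp
      then show ?thesis using zero \<beta> by blast
    qed
    show "UNIV = (UNIV :: 'a set)" ..
    show "minimal_extension X Y"
      if X: "X \<in> Field r'" and Y: "Y \<in> Field r'" and s: "underS r' Y = under r' X" for X Y
    proof -
      obtain \<beta> where \<beta>: "\<beta> \<in> Field r" "A \<beta> = Y" "underS r' Y = A ` underS r \<beta>"
        "\<forall>\<gamma>\<in>underS r \<beta>. A \<gamma> \<subset> A \<beta>" using first[of Y] Y unfolding fld by blast
      have le: "A \<gamma> \<subseteq> X" if "\<gamma> \<in> underS r \<beta>" for \<gamma>
      proof -
        have "A \<gamma> \<in> under r' X" using that \<beta>(3) s by blast
        then show ?thesis by (auto simp: under_def r'_def)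
      qed
      have "X \<in> under r' X" using X unfolding fld by (simp add: under_def r'_def)
      then obtain \<alpha> where \<alpha>: "\<alpha> \<in> underS r \<beta>" "X = A \<alpha>" using s \<beta>(3) by blast
      show ?thesis
      proof (cases "\<exists>\<zeta>\<in>Field r. underS r \<beta> = under r \<zeta>")
        case True
        then obtain \<zeta> where z: "\<zeta> \<in> Field r" "underS r \<beta> = under r \<zeta>" by blast
        have "\<zeta> \<in> under r \<zeta>" using z REFL by (auto simp: under_def refl_on_def)
        then have "A \<zeta> \<subseteq> X" using le z by blast
        moreover have "X \<subseteq> A \<zeta>" using \<alpha> z mono[of \<alpha> \<zeta>] by (simp add: under_def)
        ultimately show ?thesis using succ[OF z(1) \<beta>(1) z(2)] \<beta>(2) by simp
      next
        case False
        have "underS r \<beta> \<noteq> {}" using \<alpha>(1) by (metis emptyE)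
        then have "A \<beta> = (\<Union>\<gamma>\<in>underS r \<beta>. A \<gamma>)" by (rule lim[OF \<beta>(1) _ False])
        also have "\<dots> \<subseteq> X" by (rule UN_least) (rule le)
        finally have "A \<beta> \<subseteq> X" .
        moreover have "X \<subset> A \<beta>" using \<alpha> \<beta>(4) by simp
        ultimately show ?thesis by simp
      qed
    qed
    show "Y = (\<Union>X\<in>underS r' Y. X)"
      if Y: "Y \<in> Field r'"
        and l: "underS r' Y \<noteq> {} \<and> \<not> (\<exists>X\<in>Field r'. underS r' Y = under r' X)" for Y
    proof -
      obtain \<beta> where \<beta>: "\<beta> \<in> Field r" "A \<beta> = Y" "underS r' Y = A ` underS r \<beta>"
        "\<forall>\<gamma>\<in>underS r \<beta>. A \<gamma> \<subset> A \<beta>" using first[of Y] Y unfolding fld by blast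
      have "\<not> (\<exists>\<zeta>\<in>Field r. underS r \<beta> = under r \<zeta>)"
      proof
        assume "\<exists>\<zeta>\<in>Field r. underS r \<beta> = under r \<zeta>"
        then obtain \<zeta> where z: "\<zeta> \<in> Field r" "underS r \<beta> = under r \<zeta>" by blast
        have zz: "\<zeta> \<in> under r \<zeta>" using z REFL by (auto simp: under_def refl_on_def)
        then have zY: "A \<zeta> \<subset> Y" using \<beta>(2,4) z(2) by simp
        have "underS r' Y = under r' (A \<zeta>)"
        proof (intro equalityI subsetI)
          fix Z assume "Z \<in> underS r' Y"
          then obtain \<gamma> where "\<gamma> \<in> under r \<zeta>" "Z = A \<gamma>" using \<beta>(3) z(2) by auto
          moreover have "\<gamma> \<in> Field r" using \<open>\<gamma> \<in> under r \<zeta>\<close> by (auto simp: under_def intro: FieldI1)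
          ultimately show "Z \<in> under r' (A \<zeta>)"
            using mono[of \<gamma> \<zeta>] z(1) by (auto simp: under_def r'_def C_def)
        next
          fix Z assume "Z \<in> under r' (A \<zeta>)"
          then show "Z \<in> underS r' Y"
            using zY Y unfolding fld by (auto simp: under_def underS_def r'_def)
        qed
        moreover have "A \<zeta> \<in> Field r'" using z(1) unfolding fld C_def by (rule imageI)
        ultimately show False using l by (meson bexI)
      qed
      moreover have "underS r \<beta> \<noteq> {}" using l \<beta>(3) by simp
      ultimately have "A \<beta> = (\<Union>\<gamma>\<in>underS r \<beta>. A \<gamma>)" by (intro lim[OF \<beta>(1)])
      then show ?thesis unfolding \<beta>(3) using \<beta>(2) by simp
    qed
  qed
  then show ?thesis unfolding minimally_generated_def by blast
qed


section \<open>Stone spaces\<close>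

definition ultrafilter :: "'a::boolean_algebra set \<Rightarrow> bool" where
  "ultrafilter U \<longleftrightarrow>
     top \<in> U \<and> bot \<notin> U \<and>
     (\<forall>x\<in>U. \<forall>y\<in>U. inf x y \<in> U) \<and>
     (\<forall>x\<in>U. \<forall>y. x \<le> y \<longrightarrow> y \<in> U) \<and>
     (\<forall>x. x \<in> U \<or> - x \<in> U)"

definition stone_space :: "'a::boolean_algebra itself \<Rightarrow> 'a set topology" where
  "stone_space _ = topology_generated_by (range (\<lambda>a::'a. {U. ultrafilter U \<and> a \<in> U}))"


section \<open>Signed Radon measures\<close>

definition borel_sets :: "'x topology \<Rightarrow> 'x set set" where
  "borel_sets K = sigma_sets (topspace K) {U. openin K U}"

text \<open>
  A signed measure is a real-valued function on sets. Only its values on Borel sets are relevant.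
\<close>

definition signed_borel_measure :: "'x topology \<Rightarrow> ('x set \<Rightarrow> real) \<Rightarrow> bool" where
  "signed_borel_measure K \<mu> \<longleftrightarrow>
     \<mu> {} = 0 \<and>
     (\<forall>B :: nat \<Rightarrow> 'x set. range B \<subseteq> borel_sets K \<longrightarrow> disjoint_family B \<longrightarrow>
        (\<lambda>n. \<mu> (B n)) sums \<mu> (\<Union>n. B n))"

text \<open>
  The Jordan decomposition: the upper variation \<open>\<mu>\<^sup>+(B) = sup {\<mu>(C) | C \<subseteq> B Borel}\<close> and the lower
  variation \<open>\<mu>\<^sup>- = (-\<mu>)\<^sup>+\<close>. Taking \<open>ennreal\<close> cuts negative values off at \<open>0\<close>, which does
  not change the supremum, since \<open>C = {}\<close> is allowed.
\<close>

definition upper_variation :: "'x topology \<Rightarrow> ('x set \<Rightarrow> real) \<Rightarrow> 'x measure" where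
  "upper_variation K \<mu> =
     measure_of (topspace K) {U. openin K U} (\<lambda>B. SUP C \<in> {C \<in> borel_sets K. C \<subseteq> B}. ennreal (\<mu> C))"

definition lower_variation :: "'x topology \<Rightarrow> ('x set \<Rightarrow> real) \<Rightarrow> 'x measure" where
  "lower_variation K \<mu> = upper_variation K (\<lambda>B. - \<mu> B)"

definition total_variation :: "'x topology \<Rightarrow> ('x set \<Rightarrow> real) \<Rightarrow> 'x set \<Rightarrow> ennreal" where
  "total_variation K \<mu> B = emeasure (upper_variation K \<mu>) B + emeasure (lower_variation K \<mu>) B"

definition signed_integral :: "'x topology \<Rightarrow> ('x set \<Rightarrow> real) \<Rightarrow> ('x \<Rightarrow> real) \<Rightarrow> real" where
  "signed_integral K \<mu> f =
     integral\<^sup>L (upper_variation K \<mu>) f - integral\<^sup>L (lower_variation K \<mu>) f"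

definition signed_radon_measure :: "'x topology \<Rightarrow> ('x set \<Rightarrow> real) \<Rightarrow> bool" where
  "signed_radon_measure K \<mu> \<longleftrightarrow>
     signed_borel_measure K \<mu> \<and>
     (\<forall>B\<in>borel_sets K. \<forall>\<epsilon>>0. \<exists>L\<subseteq>B. compactin K L \<and> L \<in> borel_sets K \<and>
        total_variation K \<mu> (B - L) < ennreal \<epsilon>)"

text \<open>\<open>\<mu> = (\<Sum>x\<in>S. \<alpha> x * \<delta>\<^sub>x)\<close> with \<open>S\<close> countable and \<open>\<alpha>\<close> absolutely summable on \<open>S\<close>.\<close>

definition ell1_measure :: "'x topology \<Rightarrow> ('x set \<Rightarrow> real) \<Rightarrow> bool" where
  "ell1_measure K \<mu> \<longleftrightarrow>
     (\<exists>S \<alpha>. countable S \<and> S \<subseteq> topspace K \<and> (\<lambda>x. \<bar>\<alpha> x\<bar>) summable_on S \<and>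
        (\<forall>B\<in>borel_sets K. \<mu> B = (\<Sum>\<^sub>\<infinity>x\<in>S. \<alpha> x * indicator B x)))"


section \<open>The \<open>\<ell>\<^sub>1\<close>-Grothendieck property\<close>

definition weakstar_converges ::
    "'x topology \<Rightarrow> (nat \<Rightarrow> 'x set \<Rightarrow> real) \<Rightarrow> ('x set \<Rightarrow> real) \<Rightarrow> bool" where
  "weakstar_converges K \<mu> \<nu> \<longleftrightarrow>
     (\<forall>f. continuous_map K euclideanreal f \<longrightarrow>
        (\<lambda>n. signed_integral K (\<mu> n) f) \<longlonglongrightarrow> signed_integral K \<nu> f)"

definition weakly_converges ::
    "'x topology \<Rightarrow> (nat \<Rightarrow> 'x set \<Rightarrow> real) \<Rightarrow> ('x set \<Rightarrow> real) \<Rightarrow> bool" where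
  "weakly_converges K \<mu> \<nu> \<longleftrightarrow> (\<forall>B\<in>borel_sets K. (\<lambda>n. \<mu> n B) \<longlonglongrightarrow> \<nu> B)"

text \<open>Meant for compact Hausdorff \<open>K\<close>.\<close>

definition ell1_Grothendieck_space :: "'x topology \<Rightarrow> bool" where
  "ell1_Grothendieck_space K \<longleftrightarrow>
     (\<forall>\<mu> :: nat \<Rightarrow> 'x set \<Rightarrow> real.
        (\<forall>n. ell1_measure K (\<mu> n)) \<longrightarrow>
        (\<exists>\<nu>. signed_radon_measure K \<nu> \<and> weakstar_converges K \<mu> \<nu>) \<longrightarrow>
        (\<exists>\<nu>. signed_radon_measure K \<nu> \<and> weakly_converges K \<mu> \<nu>))"

definition ell1_Grothendieck :: "'a::boolean_algebra itself \<Rightarrow> bool" where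
  "ell1_Grothendieck _ \<longleftrightarrow> ell1_Grothendieck_space (stone_space TYPE('a))"

end

theory Submission
  imports Defs
begin

text \<open>
  To refute the \<open>\<ell>\<^sub>1\<close>-Grothendieck property it suffices to find nonempty finite sets \<open>X n\<close>, \<open>Y n\<close> of
  ultrafilters with \<open>|X n| = |Y n|\<close>, all the \<open>X n\<close> disjoint from each other and from all the
  \<open>Y n\<close>, such that the measures
  \<open>\<mu> n = (\<Sum>x\<in>X n. \<delta>\<^sub>x - \<Sum>y\<in>Y n. \<delta>\<^sub>y) / |X n|\<close> converge to \<open>0\<close> on every clopen set. A continuous
  function on the Stone space is a uniform limit of functions with finitely many values that are
  constant on clopen sets, and the measures have norm \<open>2\<close>, so they converge weakly* to \<open>0\<close>. They
  do not converge on the Borel set \<open>\<Union>k. X (2 * k)\<close>: there they take the value \<open>1\<close> for even \<open>n\<close> and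
  \<open>0\<close> for odd \<open>n\<close> (\<open>not_ell1_Grothendieck_if_mean_differences_null\<close>).

  Let \<open>J\<close> be the ideal of those \<open>a\<close> that lie in finitely many ultrafilters only; it is proper since
  the algebra is infinite. Say that \<open>x\<close> splits \<open>a\<close> if \<open>inf a x\<close> and \<open>inf a (- x)\<close> are both
  outside \<open>J\<close>. If some \<open>a \<notin> J\<close> is split by nothing, then any sequence of distinct ultrafilters
  containing \<open>a\<close> converges, and differences of point masses at consecutive terms will do
  (\<open>not_ell1_Grothendieck_if_convergent_sequence\<close>).

  Otherwise the algebra is atomless modulo \<open>J\<close>, and a binary tree of elements outside \<open>J\<close> is grown
  from \<open>top\<close>: a node \<open>a\<close> waits until the first stage of the generating sequence that contains an
  element splitting it, and is then divided by such an element into its two children. The measure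
  that gives mass \<open>1 / 2 ^ n\<close> to each node of level \<open>n\<close> has no point masses. A minimal extension of
  algebras splits at most one ultrafilter of the smaller algebra, so it adds no element whose
  boundary has positive measure for a measure that does not charge this ultrafilter; and if the
  ultrafilter is charged, it is concentrated on a node that is waiting, and the extension merely
  divides that node. By induction along the stages, every element of the algebra splits only
  \<open>o(2 ^ n)\<close> of the nodes of level \<open>n\<close> (\<open>split_density_tendsto_0\<close>). Let \<open>X n\<close> and \<open>Y n\<close> consist of
  one ultrafilter avoiding \<open>J\<close> for each first and for each second child, respectively, of a node of
  level \<open>n\<close>, all distinct and containing the child.
  A node not split by \<open>a\<close> contributes \<open>0\<close> to the value of \<open>\<mu> n\<close> at \<open>a\<close>, so these values tend
  to \<open>0\<close> (\<open>not_ell1_Grothendieck_if_splitting\<close>).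
\<close>

section \<open>Ultrafilters\<close>

lemma ultrafilter_top: "ultrafilter V \<Longrightarrow> top \<in> V"
  and ultrafilter_bot: "ultrafilter V \<Longrightarrow> bot \<notin> V"
  and ultrafilter_mono: "ultrafilter V \<Longrightarrow> x \<in> V \<Longrightarrow> x \<le> y \<Longrightarrow> y \<in> V"
  by (auto simp: ultrafilter_def)

lemma ultrafilter_inf: "ultrafilter V \<Longrightarrow> inf x y \<in> V \<longleftrightarrow> x \<in> V \<and> y \<in> V"
  by (meson ultrafilter_def inf.cobounded1 inf.cobounded2)

lemma ultrafilter_compl: "ultrafilter V \<Longrightarrow> - x \<in> V \<longleftrightarrow> x \<notin> V"
  using ultrafilter_inf[of V x "- x"] ultrafilter_bot[of V]
  unfolding ultrafilter_def by fastforce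

lemma ultrafilter_sup: "ultrafilter V \<Longrightarrow> sup x y \<in> V \<longleftrightarrow> x \<in> V \<or> y \<in> V"
  using ultrafilter_inf[of V "- x" "- y"]
  by (metis compl_sup ultrafilter_compl)

lemmas ultrafilter_simps =
  ultrafilter_top ultrafilter_bot ultrafilter_inf ultrafilter_compl ultrafilter_sup

definition ba_ideal :: "'a::boolean_algebra set \<Rightarrow> bool" where
  "ba_ideal J \<longleftrightarrow>
     bot \<in> J \<and> (\<forall>x\<in>J. \<forall>y. y \<le> x \<longrightarrow> y \<in> J) \<and> (\<forall>x\<in>J. \<forall>y\<in>J. sup x y \<in> J)"

lemma ba_ideal_bot: "ba_ideal J \<Longrightarrow> bot \<in> J"
  and ba_ideal_mono: "ba_ideal J \<Longrightarrow> x \<in> J \<Longrightarrow> y \<le> x \<Longrightarrow> y \<in> J"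
  and ba_ideal_sup: "ba_ideal J \<Longrightarrow> x \<in> J \<Longrightarrow> y \<in> J \<Longrightarrow> sup x y \<in> J"
  by (auto simp: ba_ideal_def)

lemma ba_ideal_adjoin:
  assumes "ba_ideal J"
  shows "ba_ideal {y. \<exists>j\<in>J. y \<le> sup j x}"
  unfolding ba_ideal_def
proof (intro conjI ballI allI impI)
  show "bot \<in> {y. \<exists>j\<in>J. y \<le> sup j x}" using ba_ideal_bot[OF assms] by auto
next
  fix u v assume "u \<in> {y. \<exists>j\<in>J. y \<le> sup j x}" "v \<le> u"
  then show "v \<in> {y. \<exists>j\<in>J. y \<le> sup j x}" by (auto intro: order_trans)
next
  fix u v assume "u \<in> {y. \<exists>j\<in>J. y \<le> sup j x}" "v \<in> {y. \<exists>j\<in>J. y \<le> sup j x}"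
  then obtain i j where "i \<in> J" "u \<le> sup i x" "j \<in> J" "v \<le> sup j x" by auto
  moreover from this have "sup u v \<le> sup (sup i x) (sup j x)" by (intro sup_mono)
  ultimately have "sup i j \<in> J" "sup u v \<le> sup (sup i j) x"
    using ba_ideal_sup[OF assms] by (simp_all add: ac_simps)
  then show "sup u v \<in> {y. \<exists>j\<in>J. y \<le> sup j x}" by blast
qed

text \<open>
  Zorn's lemma: the complement of a maximal proper ideal above \<open>J\<close> is an ultrafilter. Maximality
  makes the ideal prime, because adjoining \<open>x\<close> and adjoining \<open>- x\<close> cannot both be improper
  without the ideal itself being so.
\<close>

lemma ultrafilter_avoiding_ideal:
  assumes J: "ba_ideal J" and "top \<notin> J"
  obtains V where "ultrafilter V" "V \<inter> J = {}"
proof -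
  define P where "P = {I. ba_ideal I \<and> top \<notin> I \<and> J \<subseteq> I}"
  have "\<exists>M\<in>P. \<forall>X\<in>P. M \<subseteq> X \<longrightarrow> X = M"
  proof (rule subset_Zorn_nonempty)
    show "P \<noteq> {}" using assms by (auto simp: P_def)
    fix \<C> assume c: "\<C> \<noteq> {}" "subset.chain P \<C>"
    then have sub: "\<And>I. I \<in> \<C> \<Longrightarrow> ba_ideal I \<and> top \<notin> I \<and> J \<subseteq> I"
      by (auto simp: P_def subset.chain_def)
    have "ba_ideal (\<Union>\<C>)"
      unfolding ba_ideal_def
    proof (intro conjI ballI allI impI)
      show "bot \<in> \<Union>\<C>" using c(1) sub ba_ideal_bot by blast
      show "y \<in> \<Union>\<C>" if "x \<in> \<Union>\<C>" "y \<le> x" for x y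
        using that sub ba_ideal_mono by blast
      show "sup x y \<in> \<Union>\<C>" if xy: "x \<in> \<Union>\<C>" "y \<in> \<Union>\<C>" for x y
      proof -
        obtain X Y where XY: "X \<in> \<C>" "x \<in> X" "Y \<in> \<C>" "y \<in> Y" using xy by blast
        then have "X \<subseteq> Y \<or> Y \<subseteq> X" using subset_chain_def c(2) by metis
        then show ?thesis using XY sub ba_ideal_sup by blast
      qed
    qed
    then show "\<Union>\<C> \<in> P" using c(1) sub by (auto simp: P_def)
  qed
  then obtain M where "M \<in> P" and maxP: "\<forall>X\<in>P. M \<subseteq> X \<longrightarrow> X = M" by (rule bexE)
  then have M: "ba_ideal M" "top \<notin> M" "J \<subseteq> M" by (simp_all add: P_def)
  have max: "I = M" if "ba_ideal I" "top \<notin> I" "M \<subseteq> I" for I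
  proof -
    have "I \<in> P" using that M(3) by (simp add: P_def)
    then show ?thesis using bspec[OF maxP] that(3) by simp
  qed
  have prime: "x \<in> M \<or> - x \<in> M" for x
  proof (rule ccontr)
    assume undecided: "\<not> (x \<in> M \<or> - x \<in> M)"
    have ext: "\<exists>j\<in>M. sup j y = top" if "y \<notin> M" for y
    proof -
      let ?I = "{z. \<exists>j\<in>M. z \<le> sup j y}"
      have "M \<subseteq> ?I" by (auto intro: le_supI1)
      moreover have "y \<in> ?I" using ba_ideal_bot[OF M(1)] by (auto intro!: bexI[of _ bot])
      ultimately have "top \<in> ?I" using max[OF ba_ideal_adjoin[OF M(1)], of y] that by blast
      then show ?thesis by (auto simp: top_unique)
    qed
    obtain i j where ij: "i \<in> M" "sup i x = top" "j \<in> M" "sup j (- x) = top"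
      using ext[of x] ext[of "- x"] undecided by blast
    have "- x \<le> i" using ij(2) by (simp add: sup.commute[of i] sup_shunt)
    moreover have "x \<le> j" using ij(4) sup_shunt[of "- x" j] by (simp add: sup.commute)
    ultimately have "sup (- x) x \<le> sup i j" by (rule sup_mono)
    then have "top \<le> sup i j" by simp
    then show False using ba_ideal_sup[OF M(1) ij(1,3)] M(2) by (simp add: top_unique)
  qed
  have "ultrafilter (- M)"
    unfolding ultrafilter_def
  proof (intro conjI ballI allI impI)
    show "top \<in> - M" using M by simp
    show "bot \<notin> - M" using ba_ideal_bot[OF M(1)] by simp
    show "inf x y \<in> - M" if "x \<in> - M" "y \<in> - M" for x y
    proof
      assume "inf x y \<in> M"
      moreover have "- x \<in> M" "- y \<in> M" using that prime by auto
      ultimately have "sup (inf x y) (sup (- x) (- y)) \<in> M" using ba_ideal_sup[OF M(1)] by blast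
      moreover have "sup (inf x y) (sup (- x) (- y)) = top"
        by (simp flip: compl_inf)
      ultimately show False using M(2) by simp
    qed
    show "y \<in> - M" if "x \<in> - M" "x \<le> y" for x y using that ba_ideal_mono[OF M(1)] by blast
    show "x \<in> - M \<or> - x \<in> - M" for x
    proof (rule ccontr)
      assume "\<not> ?thesis"
      then have "sup x (- x) \<in> M" using ba_ideal_sup[OF M(1)] by blast
      then show False using M(2) by simp
    qed
  qed
  then show ?thesis using that M(3) by blast
qed

text \<open>
  Elements are determined by the ultrafilters that contain them. Below, identities and inequalities
  of Boolean terms are reduced in this way to propositional logic.
\<close>

lemma le_iff_ultrafilter:
  "x \<le> y \<longleftrightarrow> (\<forall>V. ultrafilter V \<longrightarrow> x \<in> V \<longrightarrow> y \<in> V)"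
proof (intro iffI)
  show "x \<le> y \<Longrightarrow> \<forall>V. ultrafilter V \<longrightarrow> x \<in> V \<longrightarrow> y \<in> V"
    using ultrafilter_mono by blast
next
  assume *: "\<forall>V. ultrafilter V \<longrightarrow> x \<in> V \<longrightarrow> y \<in> V"
  show "x \<le> y"
  proof (rule ccontr)
    assume "\<not> x \<le> y"
    \<comment> \<open>An ultrafilter avoiding this principal ideal contains \<open>x\<close> but not \<open>y\<close>.\<close>
    let ?J = "{z. z \<le> sup (- x) y}"
    have "ba_ideal ?J" by (auto simp: ba_ideal_def intro: order_trans)
    moreover have "top \<notin> ?J"
      using \<open>\<not> x \<le> y\<close> by (simp add: top_unique sup_shunt)
    ultimately obtain V where V: "ultrafilter V" "V \<inter> ?J = {}"
      by (rule ultrafilter_avoiding_ideal)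
    then have "- x \<notin> V" "y \<notin> V" by auto
    then show False using * V(1) by (auto simp: ultrafilter_simps)
  qed
qed

lemma ultrafilter_leI: "(\<And>V. ultrafilter V \<Longrightarrow> x \<in> V \<Longrightarrow> y \<in> V) \<Longrightarrow> x \<le> y"
  using le_iff_ultrafilter by blast

lemma ultrafilter_eqI: "(\<And>V. ultrafilter V \<Longrightarrow> x \<in> V \<longleftrightarrow> y \<in> V) \<Longrightarrow> x = y"
  by (rule antisym) (auto intro: ultrafilter_leI)

section \<open>Minimal extensions\<close>

text \<open>
  The elements of this form make up the subalgebra generated by \<open>C\<close> and \<open>b\<close>, which can only be \<open>B\<close>.
\<close>

lemma minimal_extension_elements:
  assumes min: "minimal_extension C B" and b: "b \<in> B" "b \<notin> C" and "x \<in> B"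
  obtains c d where "c \<in> C" "d \<in> C" "x = sup (inf c b) (inf d (- b))"
proof -
  let ?f = "\<lambda>c d. sup (inf c b) (inf d (- b))"
  let ?D = "{?f c d | c d. c \<in> C \<and> d \<in> C}"
  have C: "subalgebra C" "C \<subseteq> B" and B: "subalgebra B"
    and no: "\<not> (\<exists>D. subalgebra D \<and> C \<subset> D \<and> D \<subset> B)"
    using min by (auto simp: minimal_extension_def)
  have D: "y \<in> ?D" if "c \<in> C" "d \<in> C" "y = ?f c d" for y c d using that by blast
  have "subalgebra ?D"
    unfolding subalgebra_def
  proof (intro conjI ballI)
    show "bot \<in> ?D" using C by (intro D[of bot bot]) (auto simp: subalgebra_def)
    show "top \<in> ?D" using C by (intro D[of top top]) (auto simp: subalgebra_def)
    fix y assume "y \<in> ?D"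
    then obtain c d where cd: "c \<in> C" "d \<in> C" "y = ?f c d" by blast
    have "- y = ?f (- c) (- d)"
      unfolding cd(3) by (rule ultrafilter_eqI) (auto simp: ultrafilter_simps)
    then show "- y \<in> ?D" using C cd by (intro D[of "- c" "- d"]) (auto simp: subalgebra_def)
    fix y' assume "y' \<in> ?D"
    then obtain c' d' where cd': "c' \<in> C" "d' \<in> C" "y' = ?f c' d'" by blast
    have "inf y y' = ?f (inf c c') (inf d d')"
      unfolding cd(3) cd'(3) by (rule ultrafilter_eqI) (auto simp: ultrafilter_simps)
    then show "inf y y' \<in> ?D" using C cd cd'
      by (intro D[of "inf c c'" "inf d d'"]) (auto simp: subalgebra_def)
    have "sup y y' = ?f (sup c c') (sup d d')"
      unfolding cd(3) cd'(3) by (rule ultrafilter_eqI) (auto simp: ultrafilter_simps)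
    then show "sup y y' \<in> ?D" using C cd cd'
      by (intro D[of "sup c c'" "sup d d'"]) (auto simp: subalgebra_def)
  qed
  moreover have "C \<subset> ?D"
  proof
    have "c = ?f c c" for c by (rule ultrafilter_eqI) (auto simp: ultrafilter_simps)
    then show "C \<subseteq> ?D" using D by blast
    have "b \<in> ?D" using C by (intro D[of top bot]) (auto simp: subalgebra_def)
    then show "C \<noteq> ?D" using b by metis
  qed
  moreover have "?D \<subseteq> B" using C(2) B b(1) by (auto simp: subalgebra_def subset_iff)
  ultimately have "?D = B" using no by blast
  then show ?thesis using that \<open>x \<in> B\<close> by blast
qed

text \<open>
  For \<open>x \<notin> C\<close> the elements \<open>c\<close> of \<open>C\<close> with \<open>inf x c \<in> C\<close> thus form a prime ideal of \<open>C\<close>. The dual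
  ultrafilter is the only one of \<open>C\<close> that does not decide \<open>x\<close>. If \<open>inf x c \<notin> C\<close>, then \<open>inf x c\<close>
  already generates \<open>B\<close> over \<open>C\<close>, and below \<open>- c\<close> it adds nothing.
\<close>

lemma minimal_extension_dichotomy:
  assumes min: "minimal_extension C B" and x: "x \<in> B" and c: "c \<in> C"
  shows "inf x c \<in> C \<or> inf x (- c) \<in> C"
proof (rule ccontr)
  assume *: "\<not> ?thesis"
  have sub: "subalgebra C" "C \<subseteq> B" "subalgebra B"
    using min by (auto simp: minimal_extension_def)
  then have "inf x c \<in> B" using x c by (auto simp: subalgebra_def)
  then obtain d e where de: "d \<in> C" "e \<in> C"
    "x = sup (inf d (inf x c)) (inf e (- inf x c))"
    using minimal_extension_elements[OF min _ _ x] * by blast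
  have "inf x (- c) = inf e (- c)"
    by (subst de(3), rule ultrafilter_eqI) (auto simp: ultrafilter_simps)
  then show False using * de c sub by (auto simp: subalgebra_def)
qed

section \<open>Consecutive stages of a generating sequence\<close>

text \<open>
  This is what remains of a generating sequence when only its pairs of consecutive stages are kept.
  The third condition replaces well-foundedness and continuity at limits: a property that fails for
  \<open>bot\<close> and \<open>top\<close> is first met, if at all, at a successor stage.
\<close>

definition generating_steps :: "('a::boolean_algebra set \<times> 'a set) set \<Rightarrow> bool" where
  "generating_steps S \<longleftrightarrow>
     (\<forall>(C, B)\<in>S. minimal_extension C B) \<and>
     (\<forall>(C, B)\<in>S. \<forall>(C', B')\<in>S. B \<subseteq> C' \<or> B' \<subseteq> C \<or> (C = C' \<and> B = B')) \<and>
     (\<forall>Q. \<not> Q bot \<longrightarrow> \<not> Q top \<longrightarrow> (\<exists>x. Q x) \<longrightarrow>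
        (\<exists>(C, B)\<in>S. (\<forall>x\<in>C. \<not> Q x) \<and> (\<exists>x\<in>B. Q x)))"

lemma generating_steps_exist:
  assumes "minimally_generated TYPE('a::boolean_algebra)"
  obtains S :: "('a::boolean_algebra set \<times> 'a set) set" where "generating_steps S"
proof -
  obtain r :: "'a set rel" and \<delta> and A :: "'a set \<Rightarrow> 'a set"
    where gs: "generating_sequence r \<delta> A"
    using assms unfolding minimally_generated_def by blast
  have gs': "Well_order r" "\<delta> \<in> Field r"
    "\<forall>\<alpha> \<beta>. (\<alpha>, \<beta>) \<in> r \<longrightarrow> A \<alpha> \<subseteq> A \<beta>"
    "\<forall>\<alpha>\<in>Field r. underS r \<alpha> = {} \<longrightarrow> A \<alpha> = {bot, top}"
    "A \<delta> = UNIV"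
    "\<forall>\<alpha>\<in>Field r. \<forall>\<beta>\<in>Field r. underS r \<beta> = under r \<alpha> \<longrightarrow> minimal_extension (A \<alpha>) (A \<beta>)"
    "\<forall>\<gamma>\<in>Field r. underS r \<gamma> \<noteq> {} \<and> \<not> (\<exists>\<alpha>\<in>Field r. underS r \<gamma> = under r \<alpha>) \<longrightarrow>
        A \<gamma> = (\<Union>\<alpha>\<in>underS r \<gamma>. A \<alpha>)"
    using gs[unfolded generating_sequence_def] by - (elim conjE, assumption)+
  note wo = gs'(1) and mono = gs'(3)[rule_format] and zero = gs'(4)[rule_format]
    and succ = gs'(6)[rule_format] and lim = gs'(7)[rule_format, OF _ conjI]
  have wr: "wo_rel r" by (simp add: wo_rel_def wo)
  note TOTALS = wo_rel.TOTALS[OF wr] and LIN = wo_rel.LIN[OF wr]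
    and REFL = wo_rel.REFL[OF wr] and ANTISYM = wo_rel.ANTISYM[OF wr]
  have self: "\<alpha> \<in> under r \<alpha>" if "\<alpha> \<in> Field r" for \<alpha>
    using that REFL by (auto simp: under_def refl_on_def)
  have least: "\<exists>\<alpha>\<in>T. \<forall>\<beta>\<in>T. (\<alpha>, \<beta>) \<in> r" if "T \<subseteq> Field r" "T \<noteq> {}" for T
    using Linear_order_Well_order_iff[OF LIN] wo that by blast
  define S where
    "S = {(A \<alpha>, A \<beta>) | \<alpha> \<beta>. \<alpha> \<in> Field r \<and> \<beta> \<in> Field r \<and> underS r \<beta> = under r \<alpha>}"
  have "generating_steps S"
    unfolding generating_steps_def
  proof (intro conjI allI impI)
    show "\<forall>(C, B)\<in>S. minimal_extension C B" using succ by (auto simp: S_def)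
    have lt: "A \<beta> \<subseteq> A \<alpha>'"
      if "(\<beta>, \<beta>') \<in> r" "\<beta> \<noteq> \<beta>'" "underS r \<beta>' = under r \<alpha>'" for \<beta> \<beta>' \<alpha>'
    proof -
      have "\<beta> \<in> under r \<alpha>'" using that by (auto simp: underS_def)
      then show ?thesis using mono by (simp add: under_def)
    qed
    have "B \<subseteq> C' \<or> B' \<subseteq> C \<or> (C = C' \<and> B = B')"
      if "(C, B) \<in> S" "(C', B') \<in> S" for C B C' B'
    proof -
      obtain \<alpha> \<beta> \<alpha>' \<beta>' where ab: "C = A \<alpha>" "B = A \<beta>" "C' = A \<alpha>'" "B' = A \<beta>'"
        "\<alpha> \<in> Field r" "\<beta> \<in> Field r" "\<alpha>' \<in> Field r" "\<beta>' \<in> Field r"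
        "underS r \<beta> = under r \<alpha>" "underS r \<beta>' = under r \<alpha>'"
        using \<open>(C, B) \<in> S\<close> \<open>(C', B') \<in> S\<close> by (auto simp: S_def)
      consider "\<beta> = \<beta>'" | "\<beta> \<noteq> \<beta>'" "(\<beta>, \<beta>') \<in> r" | "\<beta> \<noteq> \<beta>'" "(\<beta>', \<beta>) \<in> r"
        using TOTALS ab by blast
      then show ?thesis
      proof cases
        case 1
        then have "\<alpha> \<in> under r \<alpha>'" "\<alpha>' \<in> under r \<alpha>" using ab self by auto
        then have "\<alpha> = \<alpha>'" using ANTISYM by (auto simp: under_def antisym_def)
        then show ?thesis using 1 ab by simp
      qed (use lt[of \<beta> \<beta>' \<alpha>'] lt[of \<beta>' \<beta> \<alpha>] ab in auto)
    qed
    then show "\<forall>(C, B)\<in>S. \<forall>(C', B')\<in>S. B \<subseteq> C' \<or> B' \<subseteq> C \<or> (C = C' \<and> B = B')"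
      by blast
    fix Q :: "'a \<Rightarrow> bool"
    assume Q: "\<not> Q bot" "\<not> Q top" "\<exists>x. Q x"
    let ?T = "{\<beta>\<in>Field r. \<exists>x\<in>A \<beta>. Q x}"
    have "?T \<noteq> {}" using gs'(2,5) Q(3) by blast
    then obtain \<beta> x where \<beta>: "\<beta> \<in> Field r" "x \<in> A \<beta>" "Q x" and min: "\<forall>\<gamma>\<in>?T. (\<beta>, \<gamma>) \<in> r"
      using least[of ?T] by blast
    have before: "\<not> Q y" if "\<gamma> \<in> underS r \<beta>" "y \<in> A \<gamma>" for \<gamma> y
    proof
      assume "Q y"
      then have "(\<beta>, \<gamma>) \<in> r" using that min by (auto simp: underS_def intro: FieldI1)
      then show False using that ANTISYM by (auto simp: underS_def antisym_def)
    qed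
    have "underS r \<beta> \<noteq> {}" using zero[OF \<beta>(1)] \<beta> Q(1,2) by auto
    moreover have "\<not> A \<beta> \<subseteq> (\<Union>\<alpha>\<in>underS r \<beta>. A \<alpha>)" using before \<beta> by blast
    ultimately obtain \<alpha> where \<alpha>: "\<alpha> \<in> Field r" "underS r \<beta> = under r \<alpha>"
      using lim[OF \<beta>(1)] by blast
    then have "\<forall>y\<in>A \<alpha>. \<not> Q y" using before self by auto
    then show "\<exists>(C, B)\<in>S. (\<forall>x\<in>C. \<not> Q x) \<and> (\<exists>x\<in>B. Q x)"
      using \<beta> \<alpha> by (intro bexI[of _ "(A \<alpha>, A \<beta>)"]) (auto simp: S_def)
  qed
  then show ?thesis using that by blast
qed

section \<open>A tree of nodes, each divided at the first possible stage\<close>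

text \<open>
  In the quotient algebra modulo \<open>J\<close>, neither is \<open>a\<close> below \<open>x\<close> nor are they disjoint.
\<close>

definition splits :: "'a::boolean_algebra set \<Rightarrow> 'a \<Rightarrow> 'a \<Rightarrow> bool" where
  "splits J x a \<longleftrightarrow> inf a x \<notin> J \<and> inf a (- x) \<notin> J"

lemma splits_mono: "ba_ideal J \<Longrightarrow> splits J x b \<Longrightarrow> b \<le> a \<Longrightarrow> splits J x a"
  unfolding splits_def by (meson ba_ideal_mono inf_mono order_refl)

lemma splits_disjoint:
  assumes J: "ba_ideal J" and x: "splits J x a" and disj: "inf a c = bot"
  shows "splits J (inf x (- c)) a"
proof -
  have "a \<le> - c" using disj by (simp add: inf_shunt)
  then have "inf a (inf x (- c)) = inf a x" by (metis inf.absorb1 inf.assoc inf.commute)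
  moreover have "inf a (- x) \<le> inf a (- inf x (- c))" by (intro inf_mono) simp_all
  ultimately show ?thesis using x ba_ideal_mono[OF J] unfolding splits_def by metis
qed

text \<open>
  The invariant of the nodes of the tree. It excludes an \<open>a\<close> that enters the algebra only at, or
  after, the step that first provides elements splitting it.
\<close>

definition born_before_split ::
    "('a::boolean_algebra set \<times> 'a set) set \<Rightarrow> 'a set \<Rightarrow> 'a \<Rightarrow> bool" where
  "born_before_split S J a \<longleftrightarrow>
     a \<notin> J \<and> (\<forall>(C, B)\<in>S. (\<exists>x\<in>B. splits J x a) \<longrightarrow> a \<in> C)"

text \<open>
  The element \<open>b\<close> divides \<open>a\<close> at the step from \<open>C\<close> to \<open>B\<close>, the first one to split \<open>a\<close>, and the two
  parts are then atoms of \<open>B\<close> modulo \<open>J\<close>.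
\<close>

definition first_split ::
    "('a::boolean_algebra set \<times> 'a set) set \<Rightarrow> 'a set \<Rightarrow> 'a \<Rightarrow> 'a \<Rightarrow> bool" where
  "first_split S J a b \<longleftrightarrow>
     b \<le> a \<and> b \<notin> J \<and> inf a (- b) \<notin> J \<and>
     (\<exists>(C, B)\<in>S. a \<in> C \<and> b \<in> B \<and> (\<forall>x\<in>C. \<not> splits J x a) \<and>
        (\<forall>x\<in>B. \<not> splits J x b \<and> \<not> splits J x (inf a (- b))))"

lemma generating_steps_minimal: "generating_steps S \<Longrightarrow> (C, B) \<in> S \<Longrightarrow> minimal_extension C B"
  by (auto simp: generating_steps_def)

lemma generating_steps_linear:
  assumes "generating_steps S" "(C, B) \<in> S" "(C', B') \<in> S"
  shows "B \<subseteq> C' \<or> B' \<subseteq> C \<or> C = C' \<and> B = B'"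
proof -
  have "\<forall>(C, B)\<in>S. \<forall>(C', B')\<in>S. B \<subseteq> C' \<or> B' \<subseteq> C \<or> (C = C' \<and> B = B')"
    using assms(1) unfolding generating_steps_def by (elim conjE)
  from bspec[OF this assms(2)] show ?thesis using assms(3) by auto
qed

lemma generating_steps_first:
  assumes "generating_steps S" "\<not> Q bot" "\<not> Q top" "Q x"
  obtains C B y where "(C, B) \<in> S" "\<And>z. z \<in> C \<Longrightarrow> \<not> Q z" "y \<in> B" "Q y"
proof -
  have "\<forall>Q. \<not> Q bot \<longrightarrow> \<not> Q top \<longrightarrow> (\<exists>x. Q x) \<longrightarrow>
        (\<exists>(C, B)\<in>S. (\<forall>x\<in>C. \<not> Q x) \<and> (\<exists>x\<in>B. Q x))"
    using assms(1) unfolding generating_steps_def by (elim conjE)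
  then have "\<exists>(C, B)\<in>S. (\<forall>x\<in>C. \<not> Q x) \<and> (\<exists>x\<in>B. Q x)"
    using assms(2-4) by blast
  then show ?thesis using that by auto
qed

lemma generating_steps_induct:
  assumes S: "generating_steps S" and "P bot" "P top"
    and step: "\<And>C B x. (C, B) \<in> S \<Longrightarrow> (\<And>y. y \<in> C \<Longrightarrow> P y) \<Longrightarrow> x \<in> B \<Longrightarrow> P x"
  shows "P x"
proof (rule ccontr)
  assume "\<not> P x"
  then obtain C B y where "(C, B) \<in> S" "\<And>z. z \<in> C \<Longrightarrow> \<not> \<not> P z" "y \<in> B" "\<not> P y"
    using generating_steps_first[OF S, of "\<lambda>z. \<not> P z" x] assms(2,3) by blast
  then show False using step by blast
qed

text \<open>
  At the first step \<open>(C, B)\<close> with an element \<open>y\<close> of \<open>B\<close> that splits \<open>a\<close>, the parts \<open>inf a y\<close> and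
  \<open>inf a (- y)\<close> are not split in \<open>B\<close>: on each of them an element of \<open>B\<close> agrees with an element of
  \<open>C\<close>, and elements of \<open>C\<close> do not split \<open>a\<close>.
\<close>

lemma first_split_exists:
  assumes S: "generating_steps S" and J: "ba_ideal J" and a: "born_before_split S J a"
    and "splits J y a"
  shows "\<exists>b. first_split S J a b"
proof -
  have bot: "bot \<in> J" using ba_ideal_bot[OF J] .
  then obtain C B y where CB: "(C, B) \<in> S" and C: "\<And>z. z \<in> C \<Longrightarrow> \<not> splits J z a"
    and y: "y \<in> B" "splits J y a"
    using generating_steps_first[OF S, of "\<lambda>z. splits J z a" y] \<open>splits J y a\<close>
    by (auto simp: splits_def)
  have min: "minimal_extension C B" using generating_steps_minimal[OF S CB] .
  have sub: "subalgebra B" "C \<subseteq> B" using min by (auto simp: minimal_extension_def)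
  have yC: "y \<notin> C" using C y(2) by blast
  have aC: "a \<in> C" using a CB y by (auto simp: born_before_split_def)
  have eq: "inf a (- inf a y) = inf a (- y)"
    by (rule ultrafilter_eqI) (auto simp: ultrafilter_simps)
  have "\<not> splits J x (inf a y) \<and> \<not> splits J x (inf a (- y))" if xB: "x \<in> B" for x
  proof -
    obtain c d where cd: "c \<in> C" "d \<in> C" and x: "x = sup (inf c y) (inf d (- y))"
      using minimal_extension_elements[OF min y(1) yC xB] by blast
    have "inf (inf a y) x \<le> inf a c" "inf (inf a y) (- x) \<le> inf a (- c)"
      "inf (inf a (- y)) x \<le> inf a d" "inf (inf a (- y)) (- x) \<le> inf a (- d)"
      unfolding x by (rule ultrafilter_leI; auto simp: ultrafilter_simps)+
    then show ?thesis using C[OF cd(1)] C[OF cd(2)] ba_ideal_mono[OF J]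
      unfolding splits_def by meson
  qed
  moreover have "inf a y \<in> B" using sub y aC by (auto simp: subalgebra_def)
  ultimately show ?thesis
    using CB C y aC by (intro exI[of _ "inf a y"])
      (auto simp: first_split_def splits_def eq simp del: compl_inf intro!: bexI[of _ "(C, B)"])
qed

text \<open>
  A step that splits one of the parts comes after the step to which the parts are born.
\<close>

lemma first_split_born_before_split:
  assumes S: "generating_steps S" and J: "ba_ideal J" and b: "first_split S J a b"
  shows "born_before_split S J b" "born_before_split S J (inf a (- b))"
proof -
  obtain C B where CB: "(C, B) \<in> S" "a \<in> C" "b \<in> B"
    and C: "\<And>x. x \<in> C \<Longrightarrow> \<not> splits J x a"
    and B: "\<And>x. x \<in> B \<Longrightarrow> \<not> splits J x b \<and> \<not> splits J x (inf a (- b))"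
    using b by (auto simp: first_split_def)
  have sub: "subalgebra B" "C \<subseteq> B"
    using generating_steps_minimal[OF S CB(1)] by (auto simp: minimal_extension_def)
  have *: "born_before_split S J e" if e: "e = b \<or> e = inf a (- b)" for e
    unfolding born_before_split_def
  proof (intro conjI ballI, safe)
    show False if "e \<in> J" using that e b by (auto simp: first_split_def)
    fix C' B' x assume CB': "(C', B') \<in> S" "x \<in> B'" "splits J x e"
    have "e \<le> a" using e b by (auto simp: first_split_def)
    then have "\<not> B' \<subseteq> C" using C splits_mono[OF J CB'(3)] CB' by blast
    moreover have "\<not> (B' = B)" using B e CB' by blast
    ultimately have "B \<subseteq> C'" using generating_steps_linear[OF S CB(1) CB'(1)] by blast
    moreover have "e \<in> B" using e CB sub by (auto simp: subalgebra_def)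
    ultimately show "e \<in> C'" by blast
  qed
  show "born_before_split S J b" "born_before_split S J (inf a (- b))" using * by auto
qed

text \<open>
  Nodes are addressed by the path to the root, so that \<open>w @ s\<close> is a descendant of \<open>s\<close>. The argument
  \<open>g\<close> selects the element that divides a node.
\<close>

primrec tree_node :: "('a::boolean_algebra \<Rightarrow> 'a) \<Rightarrow> bool list \<Rightarrow> 'a" where
  "tree_node g [] = top"
| "tree_node g (c # s) =
     (if c then g (tree_node g s) else inf (tree_node g s) (- g (tree_node g s)))"

lemma first_split_tree_exists:
  fixes S :: "('a::boolean_algebra set \<times> 'a set) set" and J :: "'a set"
  assumes S: "generating_steps S" and J: "ba_ideal J" and "top \<notin> J"
    and atomless: "\<And>a. a \<notin> J \<Longrightarrow> \<exists>x. splits J x a"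
  obtains g where "\<And>s. first_split S J (tree_node g s) (g (tree_node g s))"
proof -
  have ex: "\<exists>b. first_split S J a b" if "born_before_split S J a" for a
    using first_split_exists[OF S J that] atomless[of a] that
    by (auto simp: born_before_split_def)
  define g where "g a = (SOME b. first_split S J a b)" for a
  have g: "first_split S J a (g a)" if "born_before_split S J a" for a
    unfolding g_def using ex[OF that] by (rule someI_ex)
  have "born_before_split S J top"
    using \<open>top \<notin> J\<close> generating_steps_minimal[OF S]
    by (auto simp: born_before_split_def minimal_extension_def subalgebra_def)
  then have "born_before_split S J (tree_node g s)" for s
    by (induction s) (auto dest: g first_split_born_before_split[OF S J])
  then show ?thesis using that g by blast
qed

lemma tree_node_append_le:
  assumes "\<And>s. g (tree_node g s) \<le> tree_node g s"
  shows "tree_node g (w @ s) \<le> tree_node g s"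
  by (induction w) (auto intro: order_trans le_infI1 assms)

lemma tree_node_disjoint:
  assumes g: "\<And>s. g (tree_node g s) \<le> tree_node g s"
    and "length s = length t" "s \<noteq> t"
  shows "inf (tree_node g s) (tree_node g t) = bot"
  using assms(2,3)
proof (induction s t rule: list_induct2)
  case (Cons c s d t)
  show ?case
  proof (cases "s = t")
    case True
    then have "c \<noteq> d" using Cons by auto
    then show ?thesis using True by (auto intro!: ultrafilter_eqI simp: ultrafilter_simps)
  next
    case False
    have "inf (tree_node g (c # s)) (tree_node g (d # t)) \<le> inf (tree_node g s) (tree_node g t)"
      using tree_node_append_le[OF g, of "[c]" s] tree_node_append_le[OF g, of "[d]" t]
      by (intro inf_mono) simp_all
    then show ?thesis using Cons.IH[OF False] by (simp add: bot_unique)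
  qed
qed simp

lemma card_bool_lists:
  "finite {s :: bool list. length s = n}"
  "card {s :: bool list. length s = n} = 2 ^ n"
  using finite_lists_length_eq[of "UNIV :: bool set" n] card_lists_length_eq[of "UNIV :: bool set" n]
  by simp_all

definition split_nodes :: "'a::boolean_algebra set \<Rightarrow> ('a \<Rightarrow> 'a) \<Rightarrow> nat \<Rightarrow> 'a \<Rightarrow> bool list set" where
  "split_nodes J g n x = {s. length s = n \<and> splits J x (tree_node g s)}"

lemma finite_split_nodes: "finite (split_nodes J g n x)"
  unfolding split_nodes_def by (rule finite_subset[OF _ card_bool_lists(1)[of n]]) auto

text \<open>
  A node of level \<open>m\<close> that is not below \<open>t\<close> is disjoint from it, so removing \<open>t\<close> from \<open>x\<close> makes no
  difference there.
\<close>

lemma split_nodes_outside: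
  assumes J: "ba_ideal J" and g: "\<And>s. g (tree_node g s) \<le> tree_node g s"
    and s: "s \<in> split_nodes J g m x" and t: "length t \<le> m"
    and below: "\<And>w. s \<noteq> w @ t"
  shows "s \<in> split_nodes J g m (inf x (- tree_node g t))"
proof -
  let ?r = "drop (m - length t) s"
  have len: "length s = m" and x: "splits J x (tree_node g s)"
    using s by (auto simp: split_nodes_def)
  have s_eq: "s = take (m - length t) s @ ?r" by simp
  have "length ?r = length t" using len t by simp
  moreover have "?r \<noteq> t" using below s_eq by metis
  ultimately have disj: "inf (tree_node g ?r) (tree_node g t) = bot"
    by (rule tree_node_disjoint[OF g])
  have "tree_node g s \<le> tree_node g ?r"
    using tree_node_append_le[OF g, of "take (m - length t) s" ?r] s_eq by simp
  then have "inf (tree_node g s) (tree_node g t) = bot"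
    using disj by (metis inf_mono order_refl bot_unique)
  then show ?thesis using splits_disjoint[OF J x] len by (simp add: split_nodes_def)
qed

lemma card_split_nodes_le:
  assumes J: "ba_ideal J" and g: "\<And>s. g (tree_node g s) \<le> tree_node g s"
    and t: "length t \<le> m"
  shows "card (split_nodes J g m x)
    \<le> card (split_nodes J g m (inf x (- tree_node g t))) + 2 ^ (m - length t)"
proof -
  let ?E = "(\<lambda>w. w @ t) ` {w. length w = m - length t}"
  have "split_nodes J g m x \<subseteq> split_nodes J g m (inf x (- tree_node g t)) \<union> ?E"
  proof
    fix s assume s: "s \<in> split_nodes J g m x"
    show "s \<in> split_nodes J g m (inf x (- tree_node g t)) \<union> ?E"
    proof (cases "\<exists>w. s = w @ t")
      case True
      then show ?thesis using s by (auto simp: split_nodes_def)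
    next
      case False
      then show ?thesis using split_nodes_outside[OF J g s t] by blast
    qed
  qed
  then have "card (split_nodes J g m x) \<le> card (split_nodes J g m (inf x (- tree_node g t)) \<union> ?E)"
    by (intro card_mono) (auto simp: finite_split_nodes card_bool_lists)
  also have "\<dots> \<le> card (split_nodes J g m (inf x (- tree_node g t))) + card ?E"
    by (rule card_Un_le)
  also have "card ?E \<le> 2 ^ (m - length t)"
    using card_image_le[OF card_bool_lists(1)] by (simp add: card_bool_lists(2))
  finally show ?thesis by simp
qed

text \<open>
  For \<open>x \<notin> C\<close>, the ultrafilter of \<open>C\<close> that does not decide \<open>x\<close> is followed from the root, as long as
  it goes through nodes \<open>t\<close> that belong to \<open>C\<close>; then \<open>inf x (- t) \<in> C\<close> is covered by the induction
  hypothesis, and \<open>x\<close> splits further nodes only below \<open>t\<close>. If this goes on forever, nodes below \<open>t\<close>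
  make up the fraction \<open>1 / 2 ^ n\<close>, where \<open>n\<close> is the level of \<open>t\<close>, which is arbitrarily small. If it
  stops at \<open>t\<close> because the children of \<open>t\<close> are not in \<open>C\<close>, then \<open>t\<close> is divided either at the
  present step or later: either \<open>x\<close> belongs to the stage at which the children are born and does
  not split them, or it does not even split \<open>t\<close>. In both cases nothing is split below \<open>t\<close> from some
  level on.
\<close>

lemma split_density_step:
  assumes S: "generating_steps S" and J: "ba_ideal J"
    and split: "\<And>s. first_split S J (tree_node g s) (g (tree_node g s))"
    and CB: "(C, B) \<in> S" and x: "x \<in> B"
    and IH: "\<And>y. y \<in> C \<Longrightarrow> (\<lambda>n. card (split_nodes J g n y) / 2 ^ n) \<longlonglongrightarrow> 0"
  shows "(\<lambda>n. card (split_nodes J g n x) / 2 ^ n) \<longlonglongrightarrow> 0"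
proof -
  let ?N = "tree_node g" and ?f = "\<lambda>y n. card (split_nodes J g n y) / 2 ^ n"
  have min: "minimal_extension C B" using generating_steps_minimal[OF S CB] .
  have C: "bot \<in> C" "top \<in> C" "\<And>u. u \<in> C \<Longrightarrow> - u \<in> C"
    "\<And>u v. u \<in> C \<Longrightarrow> v \<in> C \<Longrightarrow> inf u v \<in> C" "\<And>u v. u \<in> C \<Longrightarrow> v \<in> C \<Longrightarrow> sup u v \<in> C"
    using min by (auto simp: minimal_extension_def subalgebra_def)
  have g: "g (?N s) \<le> ?N s" for s using split[of s] by (simp add: first_split_def)
  \<comment> \<open>The first case collects the ways in which the path can stop.\<close>
  show ?thesis
  proof (cases "\<exists>t k. length t \<le> k \<and> inf x (- ?N t) \<in> C \<and>
      (\<forall>w. k \<le> length (w @ t) \<longrightarrow> \<not> splits J x (?N (w @ t)))")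
    case True
    then obtain t k where t: "length t \<le> k" "inf x (- ?N t) \<in> C"
      and k: "\<And>w. k \<le> length (w @ t) \<Longrightarrow> \<not> splits J x (?N (w @ t))" by blast
    have "?f x m \<le> ?f (inf x (- ?N t)) m" if "k \<le> m" for m
    proof -
      have "split_nodes J g m x \<subseteq> split_nodes J g m (inf x (- ?N t))"
      proof
        fix s assume s: "s \<in> split_nodes J g m x"
        have "s \<noteq> w @ t" for w using k[of w] s that by (auto simp: split_nodes_def)
        then show "s \<in> split_nodes J g m (inf x (- ?N t))"
          using split_nodes_outside[OF J g s] t(1) that by auto
      qed
      then show ?thesis by (intro divide_right_mono) (auto intro: card_mono finite_split_nodes)
    qed
    then have "eventually (\<lambda>m. ?f x m \<le> ?f (inf x (- ?N t)) m) sequentially"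
      by (auto simp: eventually_sequentially)
    then show ?thesis
      by (intro tendsto_sandwich[OF _ _ tendsto_const IH[OF t(2)]]) simp_all
  next
    case False
    have path: "\<exists>t. length t = n \<and> ?N t \<in> C \<and> inf x (- ?N t) \<in> C" for n
    proof (induction n)
      case 0
      show ?case using C by (intro exI[of _ "[]"]) simp
    next
      case (Suc n)
      then obtain t where t: "length t = n" "?N t \<in> C" "inf x (- ?N t) \<in> C" by blast
      let ?L = "?N (True # t)" and ?R = "?N (False # t)"
      have "?L \<in> C"
      proof (rule ccontr)
        \<comment> \<open>Then the step that divides \<open>t\<close> is not before the step from \<open>C\<close> to \<open>B\<close>.\<close>
        assume L: "?L \<notin> C"
        obtain C' B' where CB': "(C', B') \<in> S" "?L \<in> B'"
          and C': "\<And>y. y \<in> C' \<Longrightarrow> \<not> splits J y (?N t)"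
          and B': "\<And>y. y \<in> B' \<Longrightarrow> \<not> splits J y ?L \<and> \<not> splits J y ?R"
          using split[of t] by (auto simp: first_split_def)
        have "\<not> B' \<subseteq> C" using L CB' by blast
        then have "x \<in> C' \<or> x \<in> B'" using generating_steps_linear[OF S CB CB'(1)] x by blast
        then have *: "\<not> splits J x ?L \<and> \<not> splits J x ?R"
        proof
          assume "x \<in> C'"
          moreover have "?L \<le> ?N t" "?R \<le> ?N t"
            using tree_node_append_le[OF g, of "[True]" t] tree_node_append_le[OF g, of "[False]" t]
            by (simp_all only: append_Cons append_Nil)
          ultimately show ?thesis using C' splits_mono[OF J] by blast
        qed (rule B')
        have "\<not> splits J x (?N (w @ t))" if "Suc n \<le> length (w @ t)" for w
        proof -
          have "w \<noteq> []" using that t(1) by auto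
          then obtain v c where "w = v @ [c]" by (metis rev_exhaust)
          then show ?thesis
            using * splits_mono[OF J] tree_node_append_le[OF g, of v "c # t"] by (cases c) auto
        qed
        then show False using False t by (metis le_SucI order_refl)
      qed
      then have R: "?R \<in> C" using C t by simp
      show ?case
      proof (cases "inf x (- ?L) \<in> C")
        case True
        then show ?thesis using \<open>?L \<in> C\<close> t by (intro exI[of _ "True # t"]) simp
      next
        case False
        then have "inf x ?L \<in> C" using minimal_extension_dichotomy[OF min x \<open>?L \<in> C\<close>] by blast
        then have "sup (inf x (- ?N t)) (inf x ?L) \<in> C" using C t by blast
        also have "sup (inf x (- ?N t)) (inf x ?L) = inf x (- ?R)"
          by (rule ultrafilter_eqI) (auto simp: ultrafilter_simps)
        finally show ?thesis using R t by (intro exI[of _ "False # t"]) simp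
      qed
    qed
    show ?thesis
    proof (rule LIMSEQ_I)
      fix \<epsilon> :: real assume "\<epsilon> > 0"
      then obtain n where n: "(1 / 2) ^ n < \<epsilon> / 2"
        using real_arch_pow_inv[of "\<epsilon> / 2" "1 / 2"] by auto
      obtain t where t: "length t = n" "inf x (- ?N t) \<in> C" using path by blast
      obtain M where M: "\<And>m. m \<ge> M \<Longrightarrow> norm (?f (inf x (- ?N t)) m - 0) < \<epsilon> / 2"
        using LIMSEQ_D[OF IH[OF t(2)], of "\<epsilon> / 2"] \<open>\<epsilon> > 0\<close> by auto
      have "norm (?f x m - 0) < \<epsilon>" if m: "m \<ge> max M n" for m
      proof -
        have "real (card (split_nodes J g m x))
            \<le> real (card (split_nodes J g m (inf x (- ?N t))) + 2 ^ (m - n))"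
          using card_split_nodes_le[OF J g, of t m x] t(1) m by (intro of_nat_mono) simp
        then have "?f x m \<le> ?f (inf x (- ?N t)) m + 2 ^ (m - n) / 2 ^ m"
          by (simp add: divide_right_mono flip: add_divide_distrib)
        also have "(2::real) ^ (m - n) / 2 ^ m = (1 / 2) ^ n"
          using m by (simp add: power_diff power_divide)
        finally have "?f x m \<le> ?f (inf x (- ?N t)) m + (1 / 2) ^ n" .
        moreover have "?f (inf x (- ?N t)) m < \<epsilon> / 2" using M[of m] m by simp
        ultimately have "?f x m < \<epsilon>" using n by linarith
        then show ?thesis by simp
      qed
      then show "\<exists>M. \<forall>m\<ge>M. norm (?f x m - 0) < \<epsilon>" by blast
    qed
  qed
qed

lemma split_density_tendsto_0:
  assumes S: "generating_steps S" and J: "ba_ideal J"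
    and split: "\<And>s. first_split S J (tree_node g s) (g (tree_node g s))"
  shows "(\<lambda>n. card (split_nodes J g n x) / 2 ^ n) \<longlonglongrightarrow> 0"
proof (rule generating_steps_induct[OF S, of _ x])
  have "split_nodes J g n bot = {}" "split_nodes J g n top = {}" for n
    using ba_ideal_bot[OF J] by (auto simp: split_nodes_def splits_def)
  then show "(\<lambda>n. card (split_nodes J g n bot) / 2 ^ n) \<longlonglongrightarrow> 0"
    "(\<lambda>n. card (split_nodes J g n top) / 2 ^ n) \<longlonglongrightarrow> 0" by simp_all
qed (rule split_density_step[OF S J split])

section \<open>Finitely supported measures\<close>

lemma finite_borel_sets:
  assumes K: "t1_space K" and F: "finite F" "F \<subseteq> topspace K"
  shows "F \<in> borel_sets K"
proof -
  have "openin K (topspace K - F)"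
    using t1_space_closedin_finite[of K] assms closedin_def by blast
  then have "topspace K - (topspace K - F) \<in> borel_sets K"
    unfolding borel_sets_def by (intro sigma_sets.Compl sigma_sets.Basic) simp
  then show ?thesis using F(2) by (simp add: double_diff)
qed

text \<open>
  The signed measure \<open>w * (\<Sum>x\<in>X. \<delta>\<^sub>x - \<Sum>y\<in>Y. \<delta>\<^sub>y)\<close>.
\<close>

definition balanced_measure :: "'x set \<Rightarrow> 'x set \<Rightarrow> real \<Rightarrow> 'x set \<Rightarrow> real" where
  "balanced_measure X Y w B = w * (real (card (X \<inter> B)) - real (card (Y \<inter> B)))"

lemma balanced_measure_swap: "- balanced_measure X Y w B = balanced_measure Y X w B"
  by (simp add: balanced_measure_def algebra_simps)

text \<open>
  Since \<open>X \<inter> B\<close> is finite, it is a Borel set, and the supremum in the upper variation of \<open>B\<close> is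
  attained there. So the upper variation is the image under inclusion of the measure on \<open>X\<close> that
  gives mass \<open>w\<close> to each point.
\<close>

lemma integral_upper_variation_balanced:
  fixes K :: "'x topology"
  assumes K: "t1_space K" and XY: "finite X" "X \<subseteq> topspace K" "finite Y" "X \<inter> Y = {}"
    and w: "0 \<le> w" and f: "continuous_map K euclideanreal f"
  shows "integral\<^sup>L (upper_variation K (balanced_measure X Y w)) f = w * (\<Sum>x\<in>X. f x)"
proof -
  let ?O = "{U. openin K U}" and ?m = "\<lambda>B. ennreal (w * real (card (X \<inter> B)))"
  let ?P = "point_measure X (\<lambda>_. ennreal w)"
  let ?N = "distr ?P (sigma (topspace K) ?O) id"
  have O: "?O \<subseteq> Pow (topspace K)" using openin_subset by auto
  have id: "id \<in> measurable ?P (sigma (topspace K) ?O)"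
    using XY(2) by (auto simp: measurable_def space_point_measure sets_point_measure O)
  have sup: "(SUP C\<in>{C\<in>borel_sets K. C \<subseteq> B}. ennreal (balanced_measure X Y w C)) = ?m B"
    if B: "B \<in> sigma_sets (topspace K) ?O" for B
  proof (rule antisym)
    show "(SUP C\<in>{C\<in>borel_sets K. C \<subseteq> B}. ennreal (balanced_measure X Y w C)) \<le> ?m B"
    proof (rule SUP_least)
      fix C assume "C \<in> {C\<in>borel_sets K. C \<subseteq> B}"
      then have "card (X \<inter> C) \<le> card (X \<inter> B)" using XY(1) by (intro card_mono) auto
      then have "real (card (X \<inter> C)) - real (card (Y \<inter> C)) \<le> real (card (X \<inter> B))" by linarith
      then show "ennreal (balanced_measure X Y w C) \<le> ?m B"
        unfolding balanced_measure_def using w by (intro ennreal_leI mult_left_mono)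
    qed
    have "X \<inter> B \<in> borel_sets K" using finite_borel_sets[OF K] XY by auto
    moreover have "X \<inter> (X \<inter> B) = X \<inter> B" "Y \<inter> (X \<inter> B) = {}" using XY(4) by auto
    then have "balanced_measure X Y w (X \<inter> B) = w * real (card (X \<inter> B))"
      by (simp add: balanced_measure_def)
    ultimately show "?m B \<le> (SUP C\<in>{C\<in>borel_sets K. C \<subseteq> B}. ennreal (balanced_measure X Y w C))"
      by (intro SUP_upper2[of "X \<inter> B"]) auto
  qed
  have N: "emeasure ?N B = ?m B" if "B \<in> sigma_sets (topspace K) ?O" for B
  proof -
    have "emeasure ?N B = emeasure ?P (B \<inter> X)"
      using that O by (subst emeasure_distr[OF id]) (simp_all add: space_point_measure)
    also have "\<dots> = (\<Sum>x\<in>B \<inter> X. ennreal w)"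
      using XY(1) by (subst emeasure_point_measure_finite) auto
    also have "\<dots> = ?m B"
      using w by (simp add: ennreal_of_nat_eq_real_of_nat Int_commute ennreal_mult mult.commute)
    finally show ?thesis .
  qed
  have "upper_variation K (balanced_measure X Y w) = measure_of (topspace K) ?O (emeasure ?N)"
    unfolding upper_variation_def using sup N by (intro measure_of_eq O) simp
  also have "\<dots> = measure_of (space ?N) (sets ?N) (emeasure ?N)"
  proof -
    have "sigma_sets (topspace K) ?O \<subseteq> Pow (topspace K)" using sigma_sets_into_sp[OF O] by blast
    then have "measure_of (topspace K) (sigma_sets (topspace K) ?O) m = measure_of (topspace K) ?O m"
      for m :: "'x set \<Rightarrow> ennreal"
      by (simp only: measure_of_def sigma_sets_sigma_sets_eq[OF O] O)
    then show ?thesis using O by simp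
  qed
  also have "\<dots> = ?N" by (rule measure_of_of_measure)
  finally have eq: "upper_variation K (balanced_measure X Y w) = ?N" .
  have "f \<in> borel_measurable (sigma (topspace K) ?O)"
  proof (rule borel_measurableI)
    fix U :: "real set" assume "open U"
    then have "openin K {x \<in> topspace K. f x \<in> U}"
      using f by (auto simp: continuous_map_def)
    then show "f -` U \<inter> space (sigma (topspace K) ?O) \<in> sets (sigma (topspace K) ?O)"
      using O by (auto simp: vimage_def Int_def conj_commute intro!: sigma_sets.Basic)
  qed
  then have "integral\<^sup>L ?N f = integral\<^sup>L ?P f"
    by (subst integral_distr[OF id]) simp_all
  also have "\<dots> = w * (\<Sum>x\<in>X. f x)"
    using XY(1) w by (simp add: sum_distrib_left lebesgue_integral_point_measure_finite)
  finally show ?thesis using eq by simp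
qed

lemma signed_integral_balanced:
  assumes K: "t1_space K" and XY: "finite X" "X \<subseteq> topspace K" "finite Y" "Y \<subseteq> topspace K" "X \<inter> Y = {}"
    and w: "0 \<le> w" and f: "continuous_map K euclideanreal f"
  shows "signed_integral K (balanced_measure X Y w) f = w * ((\<Sum>x\<in>X. f x) - (\<Sum>y\<in>Y. f y))"
proof -
  have "Y \<inter> X = {}" using XY by auto
  then show ?thesis
    unfolding signed_integral_def lower_variation_def balanced_measure_swap
    using XY by (simp add: integral_upper_variation_balanced[OF K _ _ _ _ w f] algebra_simps)
qed

lemma ell1_measure_balanced:
  fixes K :: "'x topology"
  assumes XY: "finite X" "X \<subseteq> topspace K" "finite Y" "Y \<subseteq> topspace K" "X \<inter> Y = {}"
  shows "ell1_measure K (balanced_measure X Y w)"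
  unfolding ell1_measure_def
proof (intro exI conjI ballI)
  let ?a = "\<lambda>x. if x \<in> X then w else - w"
  show "countable (X \<union> Y)" using XY by (simp add: countable_finite)
  show "X \<union> Y \<subseteq> topspace K" using XY by simp
  show "(\<lambda>x. \<bar>?a x\<bar>) summable_on X \<union> Y" using XY by (intro summable_on_finite) simp
  fix B :: "'x set"
  have card: "(\<Sum>x\<in>F. indicator B x) = real (card (F \<inter> B))" if "finite F" for F :: "'x set"
    using that by (induction F rule: finite_induct) (auto simp: Int_insert_left)
  have "(\<Sum>\<^sub>\<infinity>x\<in>X \<union> Y. ?a x * indicator B x) = (\<Sum>x\<in>X \<union> Y. ?a x * indicator B x)"
    using XY by (intro infsum_finite) simp
  also have "\<dots> = (\<Sum>x\<in>X. ?a x * indicator B x) + (\<Sum>x\<in>Y. ?a x * indicator B x)"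
    using XY by (intro sum.union_disjoint) auto
  also have "(\<Sum>x\<in>X. ?a x * indicator B x) = w * real (card (X \<inter> B))"
    using card[OF XY(1)] by (simp flip: sum_distrib_left)
  also have "(\<Sum>x\<in>Y. ?a x * indicator B x) = (\<Sum>x\<in>Y. (- w) * indicator B x)"
    using XY(5) by (intro sum.cong) auto
  also have "\<dots> = - w * real (card (Y \<inter> B))"
    using card[OF XY(3)] by (simp add: sum_negf flip: sum_distrib_left)
  finally show "balanced_measure X Y w B = (\<Sum>\<^sub>\<infinity>x\<in>X \<union> Y. ?a x * indicator B x)"
    by (simp add: balanced_measure_def algebra_simps)
qed

lemma signed_radon_measure_0: "signed_radon_measure K (\<lambda>_. 0)"
proof -
  let ?O = "{U. openin K U}"
  have O: "?O \<subseteq> Pow (topspace K)" using openin_subset by auto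
  have "upper_variation K (\<lambda>_. 0) = sigma (topspace K) ?O"
    unfolding upper_variation_def
  proof (rule measure_of_eq[OF O])
    fix B
    have "{} \<in> {C \<in> borel_sets K. C \<subseteq> B}" by (auto simp: borel_sets_def sigma_sets.Empty)
    then show "(SUP C\<in>{C \<in> borel_sets K. C \<subseteq> B}. ennreal 0) = 0"
      by (intro SUP_eq_const[THEN trans]) auto
  qed
  then have "total_variation K (\<lambda>_. 0) B = 0" for B
    by (simp add: total_variation_def lower_variation_def emeasure_sigma)
  then show ?thesis
    unfolding signed_radon_measure_def signed_borel_measure_def
    by (auto intro!: exI[of _ "{}"] simp: borel_sets_def sigma_sets.Empty)
qed

lemma signed_integral_0: "signed_integral K (\<lambda>_. 0) f = 0"
  by (simp add: signed_integral_def lower_variation_def)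

section \<open>The Stone space\<close>

lemma openin_stone_space:
  "ultrafilter V \<Longrightarrow> openin (stone_space TYPE('a)) U \<Longrightarrow> V \<in> U \<Longrightarrow>
    \<exists>a. a \<in> V \<and> (\<forall>W. ultrafilter W \<longrightarrow> a \<in> W \<longrightarrow> W \<in> U)"
  for V :: "'a::boolean_algebra set"
proof -
  assume V: "ultrafilter V" "V \<in> U" and "openin (stone_space TYPE('a)) U"
  then have "generate_topology_on (range (\<lambda>a::'a. {U. ultrafilter U \<and> a \<in> U})) U"
    by (simp add: stone_space_def openin_topology_generated_by_iff)
  then show ?thesis using V(2)
  proof induction
    case (Int A B)
    then obtain a b where "a \<in> V" "\<forall>W. ultrafilter W \<longrightarrow> a \<in> W \<longrightarrow> W \<in> A"
      "b \<in> V" "\<forall>W. ultrafilter W \<longrightarrow> b \<in> W \<longrightarrow> W \<in> B" by blast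
    then show ?case using V(1) by (intro exI[of _ "inf a b"]) (auto simp: ultrafilter_simps)
  next
    case (UN \<K>)
    then show ?case by blast
  qed auto
qed

lemma openin_stone_basic: "openin (stone_space TYPE('a)) {V. ultrafilter V \<and> a \<in> V}"
  for a :: "'a::boolean_algebra"
  unfolding stone_space_def by (rule topology_generated_by_Basis) simp

lemma topspace_stone_space:
  "topspace (stone_space TYPE('a::boolean_algebra)) = {V. ultrafilter V}"
  unfolding stone_space_def topology_generated_by_topspace
  by (auto intro: ultrafilter_top)

lemma t1_space_stone_space: "t1_space (stone_space TYPE('a::boolean_algebra))"
  unfolding t1_space_def topspace_stone_space
proof (intro ballI impI)
  fix V W :: "'a set" assume VW: "V \<in> {V. ultrafilter V}" "W \<in> {V. ultrafilter V}" "V \<noteq> W"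
  then obtain a where "a \<in> V \<longleftrightarrow> a \<notin> W" by blast
  then have "\<exists>a. a \<in> V \<and> a \<notin> W" using VW ultrafilter_compl[of V a] ultrafilter_compl[of W a] by blast
  then obtain a where "a \<in> V" "a \<notin> W" by blast
  then show "\<exists>U. openin (stone_space TYPE('a)) U \<and> V \<in> U \<and> W \<notin> U"
    using openin_stone_basic[of a] VW by blast
qed

section \<open>Measures that are null on clopen sets\<close>

definition mean_difference :: "'x set \<Rightarrow> 'x set \<Rightarrow> ('x \<Rightarrow> real) \<Rightarrow> real" where
  "mean_difference X Y h = 1 / card X * ((\<Sum>x\<in>X. h x) - (\<Sum>y\<in>Y. h y))"

lemma mean_difference_cong:
  "(\<And>x. x \<in> X \<union> Y \<Longrightarrow> h x = k x) \<Longrightarrow> mean_difference X Y h = mean_difference X Y k"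
  by (simp add: mean_difference_def)

lemma mean_difference_add:
  "mean_difference X Y (\<lambda>x. h x + k x) = mean_difference X Y h + mean_difference X Y k"
  by (simp add: mean_difference_def sum.distrib algebra_simps add_divide_distrib diff_divide_distrib)

lemma mean_difference_mult:
  "mean_difference X Y (\<lambda>x. h x * c) = mean_difference X Y h * c"
  by (simp add: mean_difference_def sum_distrib_right[symmetric] left_diff_distrib)

lemma mean_difference_le:
  assumes "X \<noteq> {}" "finite X" "card Y = card X" and le: "\<And>x. x \<in> X \<union> Y \<Longrightarrow> \<bar>h x\<bar> \<le> e"
  shows "\<bar>mean_difference X Y h\<bar> \<le> 2 * e"
proof -
  have "\<bar>\<Sum>x\<in>F. h x\<bar> \<le> card X * e" if "F \<subseteq> X \<union> Y" "card F = card X" for F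
  proof -
    have "\<bar>\<Sum>x\<in>F. h x\<bar> \<le> (\<Sum>x\<in>F. \<bar>h x\<bar>)" by (rule sum_abs)
    also have "\<dots> \<le> (\<Sum>x\<in>F. e)" using that le by (intro sum_mono) auto
    finally show ?thesis using that by simp
  qed
  from this[of X] this[of Y] have "\<bar>(\<Sum>x\<in>X. h x) - (\<Sum>y\<in>Y. h y)\<bar> \<le> card X * (2 * e)"
    using assms by simp
  moreover have "card X > 0" using assms by (simp add: card_gt_0_iff)
  ultimately show ?thesis
    by (simp add: mean_difference_def abs_mult field_simps)
qed

text \<open>
  Consider the elements \<open>a\<close> such that, on the clopen set of \<open>a\<close>, the function \<open>f\<close> is within \<open>e\<close> of
  some \<open>h\<close> on whose products with indicators of clopen sets the mean differences vanish in the
  limit. They form an ideal, since two such functions can be pasted along a clopen set. Continuity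
  of \<open>f\<close> at an ultrafilter \<open>V\<close> puts an element of \<open>V\<close> into this ideal, with \<open>h\<close> the constant \<open>f V\<close>.
  So no ultrafilter avoids the ideal, and it contains \<open>top\<close>. This is compactness of the Stone space
  in algebraic form.
\<close>

lemma mean_differences_continuous_null:
  fixes X Y :: "nat \<Rightarrow> 'a::boolean_algebra set set"
  assumes X: "\<And>n. finite (X n)" "\<And>n. X n \<noteq> {}" "\<And>n. card (Y n) = card (X n)"
    and ultra: "\<And>n V. V \<in> X n \<union> Y n \<Longrightarrow> ultrafilter V"
    and null: "\<And>a. (\<lambda>n. mean_difference (X n) (Y n) (\<lambda>V. of_bool (a \<in> V))) \<longlonglongrightarrow> 0"
    and f: "continuous_map (stone_space TYPE('a)) euclideanreal f"
  shows "(\<lambda>n. mean_difference (X n) (Y n) f) \<longlonglongrightarrow> 0"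
proof (rule LIMSEQ_I)
  fix r :: real assume "r > 0"
  \<comment> \<open>Norm \<open>2\<close> costs \<open>2 * e\<close> for replacing \<open>f\<close> by \<open>h\<close>; another \<open>e\<close> is for the value at \<open>h\<close>.\<close>
  define e where "e = r / 4"
  have e: "e > 0" using \<open>r > 0\<close> by (simp add: e_def)
  let ?L = "\<lambda>n. mean_difference (X n) (Y n)"
  define approx where "approx h a \<longleftrightarrow>
    (\<forall>c. (\<lambda>n. ?L n (\<lambda>V. of_bool (c \<in> V) * h V)) \<longlonglongrightarrow> 0) \<and>
    (\<forall>V. ultrafilter V \<longrightarrow> a \<in> V \<longrightarrow> \<bar>f V - h V\<bar> \<le> e)" for h a
  let ?I = "{a. \<exists>h. approx h a}"
  have const: "(\<lambda>n. ?L n (\<lambda>V. of_bool (c \<in> V) * r)) \<longlonglongrightarrow> 0" for c r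
    unfolding mean_difference_mult by (rule tendsto_mult_left_zero) (rule null)
  have ideal: "ba_ideal ?I"
    unfolding ba_ideal_def
  proof (intro conjI ballI allI impI)
    have "approx (\<lambda>_. 0) bot" using const[of _ 0] ultrafilter_bot by (auto simp: approx_def)
    then show "bot \<in> ?I" by blast
    show "b \<in> ?I" if "a \<in> ?I" "b \<le> a" for a b
      using that ultrafilter_mono unfolding approx_def by blast
    show "sup a b \<in> ?I" if ab: "a \<in> ?I" "b \<in> ?I" for a b
    proof -
      obtain h k where h: "approx h a" and k: "approx k b" using ab by blast
      define l where "l V = (if a \<in> V then h V else k V)" for V
      have "(\<lambda>n. ?L n (\<lambda>V. of_bool (c \<in> V) * l V)) \<longlonglongrightarrow> 0" for c
      proof -
        have "?L n (\<lambda>V. of_bool (c \<in> V) * l V) =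
            ?L n (\<lambda>V. of_bool (inf c a \<in> V) * h V) + ?L n (\<lambda>V. of_bool (inf c (- a) \<in> V) * k V)"
          for n
          unfolding mean_difference_add[symmetric]
          by (rule mean_difference_cong, drule ultra) (auto simp: l_def ultrafilter_simps)
        then show ?thesis using h k by (auto simp: approx_def intro!: tendsto_add_zero)
      qed
      moreover have "\<bar>f V - l V\<bar> \<le> e" if "ultrafilter V" "sup a b \<in> V" for V
        using that h k by (auto simp: approx_def l_def ultrafilter_sup)
      ultimately have "approx l (sup a b)" by (simp add: approx_def)
      then show ?thesis by blast
    qed
  qed
  have "top \<in> ?I"
  proof (rule ccontr)
    assume "top \<notin> ?I"
    then obtain V where V: "ultrafilter V" "V \<inter> ?I = {}"
      by (rule ultrafilter_avoiding_ideal[OF ideal])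
    have "openin (stone_space TYPE('a)) {W \<in> topspace (stone_space TYPE('a)). f W \<in> ball (f V) e}"
      using f by (intro openin_continuous_map_preimage) auto
    then obtain a where a: "a \<in> V" "\<forall>W. ultrafilter W \<longrightarrow> a \<in> W \<longrightarrow> f W \<in> ball (f V) e"
      using openin_stone_space[OF V(1), of "{W \<in> topspace (stone_space TYPE('a)). f W \<in> ball (f V) e}"]
        V(1) e by (auto simp: topspace_stone_space)
    have "approx (\<lambda>_. f V) a" using const a by (force simp: approx_def dist_real_def)
    then show False using a V(2) by blast
  qed
  then obtain h where h: "approx h top" by blast
  have "(\<lambda>n. ?L n h) \<longlonglongrightarrow> 0"
  proof -
    have "?L n (\<lambda>V. of_bool (top \<in> V) * h V) = ?L n h" for n
      by (rule mean_difference_cong, drule ultra) (simp add: ultrafilter_top)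
    moreover have "(\<lambda>n. ?L n (\<lambda>V. of_bool (top \<in> V) * h V)) \<longlonglongrightarrow> 0"
      using h unfolding approx_def by (elim conjE) (rule spec)
    ultimately show ?thesis by simp
  qed
  then obtain M where M: "\<And>n. n \<ge> M \<Longrightarrow> \<bar>?L n h\<bar> < e"
    using LIMSEQ_D[OF _ e, of "\<lambda>n. ?L n h" 0] by auto
  have "\<bar>?L n f\<bar> < r" if "n \<ge> M" for n
  proof -
    have "?L n f = ?L n (\<lambda>V. f V - h V) + ?L n h"
      unfolding mean_difference_add[symmetric] by simp
    moreover have "\<bar>f V - h V\<bar> \<le> e" if "V \<in> X n \<union> Y n" for V
      using h ultra[OF that] ultrafilter_top[of V] unfolding approx_def by blast
    then have "\<bar>?L n (\<lambda>V. f V - h V)\<bar> \<le> 2 * e" by (intro mean_difference_le X)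
    ultimately show ?thesis using M[OF that] by (simp add: e_def)
  qed
  then show "\<exists>M. \<forall>n\<ge>M. norm (?L n f - 0) < r" by auto
qed

text \<open>
  Disjointness makes the values at \<open>\<Union>k. X (2 * k)\<close> alternate between \<open>1\<close> and \<open>0\<close>, which rules out
  every weak limit, not only \<open>0\<close>.
\<close>

lemma not_ell1_Grothendieck_if_mean_differences_null:
  fixes X Y :: "nat \<Rightarrow> 'a::boolean_algebra set set"
  assumes X: "\<And>n. finite (X n)" "\<And>n. X n \<noteq> {}" "\<And>n. card (Y n) = card (X n)"
    and ultra: "\<And>n V. V \<in> X n \<union> Y n \<Longrightarrow> ultrafilter V"
    and disj: "\<And>m n. m \<noteq> n \<Longrightarrow> X m \<inter> X n = {}" "\<And>m n. X m \<inter> Y n = {}"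
    and null: "\<And>a. (\<lambda>n. mean_difference (X n) (Y n) (\<lambda>V. of_bool (a \<in> V))) \<longlonglongrightarrow> 0"
  shows "\<not> ell1_Grothendieck TYPE('a)"
proof
  let ?K = "stone_space TYPE('a)"
  define \<mu> where "\<mu> n = balanced_measure (X n) (Y n) (1 / card (X n))" for n
  have pos: "card (X n) > 0" for n using X by (simp add: card_gt_0_iff)
  then have "card (Y n) > 0" for n using X(3) by simp
  then have Y: "finite (Y n)" for n by (metis card_gt_0_iff)
  have top: "X n \<subseteq> topspace ?K" "Y n \<subseteq> topspace ?K" for n
    using ultra by (auto simp: topspace_stone_space)
  assume "ell1_Grothendieck TYPE('a)"
  moreover have "ell1_measure ?K (\<mu> n)" for n
    unfolding \<mu>_def using X Y top disj by (intro ell1_measure_balanced) auto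
  moreover have "weakstar_converges ?K \<mu> (\<lambda>_. 0)"
    unfolding weakstar_converges_def signed_integral_0
  proof (intro allI impI)
    fix f assume f: "continuous_map ?K euclideanreal f"
    have "signed_integral ?K (\<mu> n) f = mean_difference (X n) (Y n) f" for n
      unfolding \<mu>_def mean_difference_def
      by (rule signed_integral_balanced[OF t1_space_stone_space _ _ _ _ _ _ f])
        (use X Y top disj in auto)
    then show "(\<lambda>n. signed_integral ?K (\<mu> n) f) \<longlonglongrightarrow> 0"
      using mean_differences_continuous_null[OF X ultra null f] by simp
  qed
  ultimately obtain \<nu> where \<nu>: "weakly_converges ?K \<mu> \<nu>"
    unfolding ell1_Grothendieck_def ell1_Grothendieck_space_def
    using signed_radon_measure_0 by blast
  define B where "B = (\<Union>k. X (2 * k))"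
  have "X (2 * k) \<in> borel_sets ?K" for k
    by (intro finite_borel_sets t1_space_stone_space X top)
  then have "B \<in> borel_sets ?K" unfolding B_def borel_sets_def by (rule sigma_sets.Union)
  then have lim: "(\<lambda>n. \<mu> n B) \<longlonglongrightarrow> \<nu> B" using \<nu> by (simp add: weakly_converges_def)
  have YB: "Y n \<inter> B = {}" for n using disj(2) by (auto simp: B_def)
  have "X (2 * k) \<inter> B = X (2 * k)" for k by (auto simp: B_def)
  then have even: "\<mu> (2 * k) B = 1" for k
    using pos[of "2 * k"] by (simp add: \<mu>_def balanced_measure_def YB)
  have "2 * k + 1 \<noteq> 2 * j" for k j :: nat by presburger
  then have "X (2 * k + 1) \<inter> B = {}" for k using disj(1) unfolding B_def by blast
  then have odd: "\<mu> (2 * k + 1) B = 0" for k by (simp add: \<mu>_def balanced_measure_def YB)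
  have "(\<lambda>k. \<mu> (2 * k) B) \<longlonglongrightarrow> \<nu> B" "(\<lambda>k. \<mu> (2 * k + 1) B) \<longlonglongrightarrow> \<nu> B"
    using LIMSEQ_subseq_LIMSEQ[OF lim, of "\<lambda>k. 2 * k"]
      LIMSEQ_subseq_LIMSEQ[OF lim, of "\<lambda>k. 2 * k + 1"]
    by (auto simp: strict_mono_def o_def)
  then have "\<nu> B = 1" "\<nu> B = 0" unfolding even odd by (simp_all add: LIMSEQ_const_iff)
  then show False by simp
qed

section \<open>Atoms and atomless algebras modulo a proper ideal\<close>

text \<open>
  Any injective sequence of ultrafilters containing \<open>a\<close> converges: for each \<open>x\<close>, all but finitely many
  of its terms are on the same side of \<open>x\<close>.
\<close>

lemma not_ell1_Grothendieck_if_convergent_sequence: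
  fixes a :: "'a::boolean_algebra"
  assumes inf: "infinite {V. ultrafilter V \<and> a \<in> V}"
    and dec: "\<And>x. finite {V. ultrafilter V \<and> inf a x \<in> V} \<or> finite {V. ultrafilter V \<and> inf a (- x) \<in> V}"
  shows "\<not> ell1_Grothendieck TYPE('a)"
proof -
  obtain v :: "nat \<Rightarrow> 'a set" where v: "inj v" "range v \<subseteq> {V. ultrafilter V \<and> a \<in> V}"
    using infinite_countable_subset[OF inf] by blast
  have ultra: "ultrafilter (v n)" "a \<in> v n" for n using v(2) by auto
  have fin: "eventually (\<lambda>n. y \<notin> v n) sequentially"
    if "finite {V. ultrafilter V \<and> inf a y \<in> V}" for y
  proof -
    have "finite (v -` {V. ultrafilter V \<and> inf a y \<in> V})"
      using that v(1) by (intro finite_vimageI) auto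
    moreover have "{n. y \<in> v n} \<subseteq> v -` {V. ultrafilter V \<and> inf a y \<in> V}"
      using ultra by (auto simp: ultrafilter_inf)
    ultimately have "finite {n. y \<in> v n}" by (rule finite_subset[rotated])
    then show ?thesis by (simp add: eventually_cofinite flip: cofinite_eq_sequentially)
  qed
  have const: "eventually (\<lambda>n. x \<in> v n \<longleftrightarrow> b) sequentially"
    if "b \<longleftrightarrow> infinite {V. ultrafilter V \<and> inf a x \<in> V}" for x b
    using fin[of x] fin[of "- x"] dec[of x] that ultra
    by (cases b) (auto simp: ultrafilter_compl)
  show ?thesis
  proof (rule not_ell1_Grothendieck_if_mean_differences_null)
    fix x
    obtain b where "eventually (\<lambda>n. x \<in> v n \<longleftrightarrow> b) sequentially" using const by blast
    then obtain N where "\<And>n. n \<ge> N \<Longrightarrow> x \<in> v n \<longleftrightarrow> b" by (auto simp: eventually_sequentially)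
    then have "mean_difference {v (2 * n)} {v (2 * n + 1)} (\<lambda>V. of_bool (x \<in> V)) = 0" if "n \<ge> N" for n
      using that by (simp add: mean_difference_def)
    then have "eventually
      (\<lambda>n. mean_difference {v (2 * n)} {v (2 * n + 1)} (\<lambda>V. of_bool (x \<in> V)) = 0) sequentially"
      by (auto simp: eventually_sequentially)
    then show "(\<lambda>n. mean_difference {v (2 * n)} {v (2 * n + 1)} (\<lambda>V. of_bool (x \<in> V))) \<longlonglongrightarrow> 0"
      by (rule tendsto_eventually)
  next
    show "{v (2 * m)} \<inter> {v (2 * n + 1)} = {}" for m n
    proof -
      have "2 * m \<noteq> 2 * n + 1" by presburger
      then show ?thesis using injD[OF v(1)] by blast
    qed
  qed (use ultra in \<open>auto dest: injD[OF v(1)]\<close>)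
qed

text \<open>
  The ultrafilter for \<open>t\<close> contains all nodes on the branch that goes from \<open>t\<close> once to \<open>True\<close> and
  from then on always to \<open>False\<close>. Different \<open>t\<close> have different branches, even if one is below the
  other, which makes the choice injective.
\<close>

lemma branch_ultrafilters:
  assumes J: "ba_ideal J" and g: "\<And>s. g (tree_node g s) \<le> tree_node g s"
    and node: "\<And>s. tree_node g s \<notin> J"
  obtains q where "inj q" "\<And>t. ultrafilter (q t)" "\<And>t. q t \<inter> J = {}" "\<And>t. tree_node g t \<in> q t"
proof -
  let ?b = "\<lambda>t k. tree_node g (replicate k False @ True # t)"
  have "\<exists>V. ultrafilter V \<and> V \<inter> J = {} \<and> (\<forall>k. ?b t k \<in> V)" for t
  proof -
    \<comment> \<open>the elements disjoint, modulo \<open>J\<close>, from some node of the branch\<close>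
    let ?I = "{x. \<exists>k. inf (?b t k) x \<in> J}"
    have mono: "?b t l \<le> ?b t k" if "k \<le> l" for k l
    proof -
      have "replicate l False = replicate (l - k) False @ replicate k False"
        using that by (simp flip: replicate_add)
      then show ?thesis using tree_node_append_le[OF g] by simp
    qed
    have shrink: "inf (?b t l) x \<in> J" if "inf (?b t k) x \<in> J" "k \<le> l" for k l x
      using ba_ideal_mono[OF J that(1)] mono[OF that(2)] by (meson inf_mono order_refl)
    have "ba_ideal ?I"
      unfolding ba_ideal_def
    proof (intro conjI ballI allI impI)
      show "bot \<in> ?I" using ba_ideal_bot[OF J] by simp
      show "y \<in> ?I" if "x \<in> ?I" "y \<le> x" for x y
        using that ba_ideal_mono[OF J] inf_mono[OF order_refl] by blast
      show "sup x y \<in> ?I" if xy: "x \<in> ?I" "y \<in> ?I" for x y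
      proof -
        obtain k l where "inf (?b t k) x \<in> J" "inf (?b t l) y \<in> J" using xy by blast
        then have "sup (inf (?b t (max k l)) x) (inf (?b t (max k l)) y) \<in> J"
          by (intro ba_ideal_sup[OF J]) (auto elim: shrink)
        then show ?thesis by (auto simp: inf_sup_distrib1)
      qed
    qed
    moreover have "top \<notin> ?I" using node by simp
    ultimately obtain V where V: "ultrafilter V" "V \<inter> ?I = {}"
      by (rule ultrafilter_avoiding_ideal)
    have "- ?b t k \<in> ?I" for k using ba_ideal_bot[OF J] by (auto intro!: exI[of _ k])
    then have "?b t k \<in> V" for k using V ultrafilter_compl[OF V(1)] by blast
    moreover have "J \<subseteq> ?I" using ba_ideal_mono[OF J] by (auto intro: inf_le2)
    ultimately show ?thesis using V by blast
  qed
  then obtain q where q: "\<And>t. ultrafilter (q t)" "\<And>t. q t \<inter> J = {}" "\<And>t k. ?b t k \<in> q t"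
    by metis
  have "t = u" if eq: "q t = q u" and le: "length t \<le> length u" for t u
  proof -
    \<comment> \<open>The two branches are compared at the level of the children of \<open>u\<close>.\<close>
    let ?s = "replicate (length u - length t) False @ True # t"
    have "inf (tree_node g ?s) (tree_node g (True # u)) \<in> q u"
      using q(3)[of 0 u] q(3)[of _ t] eq by (simp add: ultrafilter_inf[OF q(1)])
    then have "?s = True # u"
      using tree_node_disjoint[OF g, of ?s "True # u"] le ultrafilter_bot[OF q(1)] by fastforce
    then show ?thesis by (cases "length u - length t") auto
  qed
  then have "inj q" by (metis injI nat_le_linear)
  moreover have "tree_node g t \<in> q t" for t
    using q(3)[of 0 t] tree_node_append_le[OF g, of "[True]" t] ultrafilter_mono[OF q(1)]
    by (metis append.left_neutral append_Cons replicate_0)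
  ultimately show ?thesis using that q by blast
qed

text \<open>
  An element that does not split a node belongs to all or to none of the ultrafilters that contain
  the node and avoid \<open>J\<close>. So only split nodes contribute to the mean differences.
\<close>

lemma not_ell1_Grothendieck_if_splitting:
  fixes S :: "('a::boolean_algebra set \<times> 'a set) set" and J :: "'a set"
  assumes S: "generating_steps S" and J: "ba_ideal J" and "top \<notin> J"
    and atomless: "\<And>a. a \<notin> J \<Longrightarrow> \<exists>x. splits J x a"
  shows "\<not> ell1_Grothendieck TYPE('a)"
proof -
  obtain g where split: "\<And>s. first_split S J (tree_node g s) (g (tree_node g s))"
    using first_split_tree_exists[OF assms] by blast
  have g: "g (tree_node g s) \<le> tree_node g s" for s using split[of s] by (simp add: first_split_def)
  have node: "tree_node g s \<notin> J" for s
    using \<open>top \<notin> J\<close> split by (cases s) (auto simp: first_split_def)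
  obtain q where q: "inj q" "\<And>t. ultrafilter (q t)" "\<And>t. q t \<inter> J = {}"
    "\<And>t. tree_node g t \<in> q t"
    using branch_ultrafilters[OF J g node] by blast
  let ?W = "\<lambda>n. {s :: bool list. length s = n}"
  define Z where "Z c n = (\<lambda>s. q (c # s)) ` ?W n" for c n
  have inj: "inj_on (\<lambda>s. q (c # s)) A" for c A using q(1) by (auto simp: inj_on_def dest: injD)
  have card: "card (Z c n) = 2 ^ n" for c n
    by (simp add: Z_def card_image[OF inj] card_bool_lists)
  show ?thesis
  proof (rule not_ell1_Grothendieck_if_mean_differences_null)
    show "finite (Z True n)" "Z True n \<noteq> {}" for n
      using card[of True n] card_gt_0_iff[of "Z True n"] by simp_all
    show "card (Z False n) = card (Z True n)" for n by (simp add: card)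
    show "ultrafilter V" if "V \<in> Z True n \<union> Z False n" for n V
      using that q(2) by (auto simp: Z_def)
    show "Z True m \<inter> Z True n = {}" if "m \<noteq> n" for m n
      using that by (auto simp: Z_def inj_eq[OF q(1)])
    show "Z True m \<inter> Z False n = {}" for m n
      by (auto simp: Z_def inj_eq[OF q(1)])
    fix a
    have agree: "a \<in> q (True # s) \<longleftrightarrow> a \<in> q (False # s)" if "\<not> splits J a (tree_node g s)" for s
    proof -
      have in_q: "tree_node g s \<in> q (c # s)" for c
        using q(4)[of "c # s"] tree_node_append_le[OF g, of "[c]" s] ultrafilter_mono[OF q(2)]
        by (metis append.left_neutral append_Cons)
      have "inf (tree_node g s) a \<notin> q (c # s)" if "inf (tree_node g s) a \<in> J" for c
        using that q(3) by blast
      moreover have "inf (tree_node g s) (- a) \<notin> q (c # s)" if "inf (tree_node g s) (- a) \<in> J" for c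
        using that q(3) by blast
      ultimately show ?thesis
        using that in_q by (auto simp: splits_def ultrafilter_inf[OF q(2)] ultrafilter_compl[OF q(2)])
    qed
    have bound: "\<bar>mean_difference (Z True n) (Z False n) (\<lambda>V. of_bool (a \<in> V))\<bar>
        \<le> card (split_nodes J g n a) / 2 ^ n" for n
    proof -
      let ?d = "\<lambda>s. of_bool (a \<in> q (True # s)) - of_bool (a \<in> q (False # s)) :: real"
      have "mean_difference (Z True n) (Z False n) (\<lambda>V. of_bool (a \<in> V)) = (\<Sum>s\<in>?W n. ?d s) / 2 ^ n"
        unfolding mean_difference_def card by (simp add: Z_def sum.reindex[OF inj] sum_subtractf)
      moreover have "\<bar>\<Sum>s\<in>?W n. ?d s\<bar> \<le> card (split_nodes J g n a)"
      proof -
        have "\<bar>\<Sum>s\<in>?W n. ?d s\<bar> \<le> (\<Sum>s\<in>?W n. \<bar>?d s\<bar>)" by (rule sum_abs)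
        also have "\<dots> \<le> (\<Sum>s\<in>?W n. of_bool (splits J a (tree_node g s)))"
          using agree by (intro sum_mono) auto
        also have "\<dots> = card (split_nodes J g n a)"
          by (simp add: split_nodes_def card_bool_lists Int_def)
        finally show ?thesis .
      qed
      ultimately show ?thesis by (simp add: divide_right_mono)
    qed
    show "(\<lambda>n. mean_difference (Z True n) (Z False n) (\<lambda>V. of_bool (a \<in> V))) \<longlonglongrightarrow> 0"
      by (rule Lim_null_comparison[OF always_eventually split_density_tendsto_0[OF S J split, of a]])
        (simp add: bound)
  qed
qed

lemma infinite_ultrafilters:
  assumes "infinite (UNIV :: 'a::boolean_algebra set)"
  shows "infinite {V :: 'a set. ultrafilter V}"
proof
  let ?U = "{V :: 'a set. ultrafilter V}"
  assume "finite ?U"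
  moreover have "inj (\<lambda>a :: 'a. {V \<in> ?U. a \<in> V})"
    by (rule injI, rule ultrafilter_eqI) blast
  moreover have "range (\<lambda>a :: 'a. {V \<in> ?U. a \<in> V}) \<subseteq> Pow ?U" by auto
  ultimately have "finite (UNIV :: 'a set)"
    by (meson finite_Pow_iff finite_imageD finite_subset)
  then show False using assms by simp
qed

theorem corollary9p11:
  assumes "infinite (UNIV :: 'a::boolean_algebra set)"
    and "minimally_generated TYPE('a)"
  shows "\<not> ell1_Grothendieck TYPE('a)"
proof -
  define J where "J = {a :: 'a. finite {V. ultrafilter V \<and> a \<in> V}}"
  have J: "ba_ideal J"
    unfolding ba_ideal_def
  proof (intro conjI ballI allI impI)
    show "bot \<in> J" by (simp add: J_def ultrafilter_bot cong: conj_cong)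
    show "y \<in> J" if "x \<in> J" "y \<le> x" for x y
      using that unfolding J_def by (auto elim!: finite_subset[rotated] intro: ultrafilter_mono)
    show "sup x y \<in> J" if "x \<in> J" "y \<in> J" for x y
    proof -
      have "{V. ultrafilter V \<and> sup x y \<in> V} = {V. ultrafilter V \<and> x \<in> V} \<union> {V. ultrafilter V \<and> y \<in> V}"
        by (auto simp: ultrafilter_sup)
      then show ?thesis using that by (simp add: J_def)
    qed
  qed
  have top: "top \<notin> J"
    using infinite_ultrafilters[OF assms(1)] by (simp add: J_def ultrafilter_top cong: conj_cong)
  obtain S :: "('a set \<times> 'a set) set" where S: "generating_steps S"
    using generating_steps_exist[OF assms(2)] .
  show ?thesis
  proof (cases "\<forall>a. a \<notin> J \<longrightarrow> (\<exists>x. splits J x a)")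
    case True
    then show ?thesis using not_ell1_Grothendieck_if_splitting[OF S J top] by blast
  next
    case False
    then obtain a where "a \<notin> J" "\<And>x. \<not> splits J x a" by blast
    then show ?thesis
      by (intro not_ell1_Grothendieck_if_convergent_sequence[of a]) (auto simp: J_def splits_def)
  qed
qed

end
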